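(* Let $F$ be a distribution function on $[0,1]$, suppose that $X_1,\ldots,X_n$ are i.i.d. with distribution function $F$, and let $s>1$. Then $$S_n(s)\ \xrightarrow{a.s.}\ S_\infty(s,F):=\sup_{0<x<1}K_s(F(x),x)\qquad(n\to\infty)$$ if and only if $F$ satisfies $$\int_0^1\frac{1}{\big(F^{-1}(u)(1-F^{-1}(u))\big)^{(s-1)/s}}\,du<\infty .$$ The last condition is equivalent to $E_F\big\{[X(1-X)]^{-(1-1/s)}\big\}<\infty$, where $X$ has distribution function $F$.
   Context: $\mathbb{F}_n(x)=n^{-1}\sum_{i=1}^n1\{X_i\le x\}$ is the empirical distribution function of $X_1,\ldots,X_n$; $F^{-1}(u)=\inf\{x:F(x)\ge u\}$ is the quantile function. For $s>1$, $u\in[0,1]$, $v\in(0,1)$, $$K_s(u,v)=\frac{1}{s(s-1)}\{u^sv^{1-s}+(1-u)^s(1-v)^{1-s}-1\},$$ and $S_n(s)=\sup_{0<x<1}K_s(\mathbb{F}_n(x),x)$.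
   Formalization: The almost sure convergence of S_n(s) to S_∞(s,F) is taken to include that S_∞(s,F) is finite; if convergence to an infinite limit counted, the equivalence would fail, e.g. for F(x)=x^a with 0<a<(s-1)/s. *)

theory Defs
  imports "HOL-Probability.Probability"
begin

definition cdf_on_unit :: "(real \<Rightarrow> real) \<Rightarrow> bool" where
  "cdf_on_unit F \<longleftrightarrow> mono F \<and> (\<forall>x. continuous (at_right x) F) \<and>
     (\<forall>x<0. F x = 0) \<and> (\<forall>x\<ge>1. F x = 1)"

definition emp_cdf :: "(nat \<Rightarrow> 'a \<Rightarrow> real) \<Rightarrow> nat \<Rightarrow> 'a \<Rightarrow> real \<Rightarrow> real" where
  "emp_cdf X n \<omega> x = (1 / real n) * (\<Sum>i=1..n. indicator {..x} (X i \<omega>))"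

text \<open>Only the values at \<open>0 < u < 1\<close> are meaningful: otherwise the set may be empty or
  unbounded below.\<close>

definition quantile :: "(real \<Rightarrow> real) \<Rightarrow> real \<Rightarrow> real" where
  "quantile F u = Inf {x. F x \<ge> u}"

definition K_div :: "real \<Rightarrow> real \<Rightarrow> real \<Rightarrow> real" where
  "K_div s u v = 1 / (s * (s - 1)) *
     (u powr s * v powr (1 - s) + (1 - u) powr s * (1 - v) powr (1 - s) - 1)"

text \<open>With \<open>G\<close> the empirical distribution function this is \<open>S\<^sub>n(s)\<close>, and with \<open>G = F\<close> it is
  \<open>S\<^sub>\<infinity>(s, F)\<close>. The supremum is taken in the extended reals because it can be infinite,
  for example if \<open>G\<close> has an atom at \<open>0\<close> or \<open>1\<close>.
  Convergence of \<open>S\<^sub>n(s)\<close> therefore has to be accompanied by finiteness of the limit: for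
  \<open>G x = x powr a\<close> with \<open>0 < a < (s - 1) / s\<close> on \<open>[0,1]\<close> the
  limit \<open>S\<^sub>\<infinity>(s, G)\<close> is \<open>\<infinity>\<close> and \<open>S\<^sub>n(s)\<close> tends to it almost surely.\<close>

definition sup_K_div :: "real \<Rightarrow> (real \<Rightarrow> real) \<Rightarrow> ereal" where
  "sup_K_div s G = (SUP x\<in>{0<..<1}. ereal (K_div s (G x) x))"

end

theory Submission
  imports Defs
begin

text \<open>
  Put \<open>p = (s - 1) / s\<close>. Since \<open>p * s = s - 1\<close>, the first summand of \<open>K_div s (G x) x\<close> is
  \<open>(G x * x powr (-p)) powr s\<close>, and the second one has the same form at the endpoint \<open>1\<close>. By the
  quantile transform the integral condition says that \<open>X powr (-p)\<close> and \<open>(1 - X) powr (-p)\<close> are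
  integrable.

  If they are, then for \<open>x \<le> d\<close> the quantity \<open>x powr (-p)\<close> times the empirical distribution function
  is at most the average of \<open>X\<^sub>i powr (-p)\<close> over those \<open>X\<^sub>i\<close> that are at most \<open>d\<close>. This is
  almost surely eventually small, uniformly in \<open>x\<close>, by a one-sided strong law; a law that loses a
  factor 2 is enough. Away from the endpoints the Glivenko-Cantelli theorem gives uniform convergence.

  If one of them is not integrable, say the first, then by the second Borel-Cantelli lemma, for every
  \<open>c\<close>, almost surely \<open>X\<^sub>n < x\<^sub>n := (c * n) powr (-1/p)\<close> infinitely often. For such \<open>n\<close> the
  empirical distribution function at \<open>x\<^sub>n\<close> is at least \<open>1/n\<close>, so the first summand at \<open>x\<^sub>n\<close> is at
  least \<open>c powr s\<close> and no finite limit is possible.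
\<close>

section \<open>Laws of large numbers for independent identically distributed variables\<close>

text \<open>The nonzero terms form a geometric series whose largest term is below \<open>y\<close>,
  so the series is at most twice that term. In expectation this controls the sum of
  \<open>2 ^ k\<close> times the probability that a variable exceeds \<open>2 ^ k\<close>.\<close>

lemma sum_pow2_below:
  fixes y :: real
  assumes "0 \<le> y"
  shows "(\<Sum>k<K. 2 ^ k * indicator {2 ^ k<..} y) \<le> 2 * y"
proof -
  have geo: "(\<Sum>k<K. 2 ^ k) = (2 ^ K - 1 :: real)" for K
    by (induction K) auto
  show ?thesis
  proof (induction K)
    case 0
    then show ?case using assms by simp
  next
    case (Suc K)
    show ?case
    proof (cases "2 ^ K < y")
      case True
      have "(\<Sum>k<Suc K. 2 ^ k * indicator {2 ^ k<..} y) \<le> (\<Sum>k<Suc K. 2 ^ k :: real)"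
        by (intro sum_mono) (auto simp: indicator_def)
      also have "\<dots> \<le> 2 * y"
        unfolding geo using True by simp
      finally show ?thesis .
    next
      case False
      then show ?thesis using Suc by simp
    qed
  qed
qed

text \<open>The terms vanish until \<open>2 ^ k\<close> reaches \<open>y\<close>; from there they
  are geometric with ratio 1/2 and a first term of at most \<open>y\<close>. In expectation this
  controls the Chebyshev terms of the truncated variables.\<close>

lemma sum_truncated_squares:
  fixes y :: real
  assumes "0 \<le> y"
  shows "(\<Sum>k<K. y\<^sup>2 / 2 ^ k * indicator {..2 ^ k} y) \<le> 2 * y"
proof -
  \<comment> \<open>strengthened by the remaining geometric tail, so that the induction goes through\<close>
  have "(\<Sum>k<K. y\<^sup>2 / 2 ^ k * indicator {..2 ^ k} y)
      \<le> (if 2 * y \<le> 2 ^ K then 2 * y - 2 * y\<^sup>2 / 2 ^ K else 0)"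
  proof (induction K)
    case 0
    have "2 * y * (1 - y) \<ge> 0" if "2 * y \<le> 1"
      using that assms by simp
    then show ?case by (auto simp: power2_eq_square algebra_simps)
  next
    case (Suc K)
    consider "2 * y \<le> 2 ^ K" | "2 ^ K < 2 * y" "y \<le> 2 ^ K" | "2 ^ K < y" by linarith
    then show ?case
    proof cases
      case 1
      then have "y \<le> 2 ^ K" using assms by linarith
      moreover have "2 * y\<^sup>2 / 2 ^ Suc K = y\<^sup>2 / 2 ^ K" "2 * y\<^sup>2 / 2 ^ K = 2 * (y\<^sup>2 / 2 ^ K)"
        by simp_all
      ultimately show ?thesis using 1 Suc by auto
    next
      case 2
      \<comment> \<open>Here \<open>K\<close> is the first contributing index: the induction
        hypothesis bounds the earlier terms by 0, and only the single new term has to be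
        estimated.\<close>
      have "y * y \<le> y * 2 ^ K" using 2 assms by (intro mult_left_mono) auto
      then have "y\<^sup>2 / 2 ^ K \<le> y" by (simp add: field_simps power2_eq_square)
      moreover have "2 * y\<^sup>2 / 2 ^ Suc K = y\<^sup>2 / 2 ^ K" by simp
      ultimately show ?thesis using 2 Suc by auto
    next
      case 3
      then have "2 ^ K < 2 * y" using assms by linarith
      with 3 Suc show ?thesis by auto
    qed
  qed
  also have "\<dots> \<le> 2 * y" using assms by auto
  finally show ?thesis .
qed

text \<open>Independent centred variables are orthogonal: in the induction the new variable is
  independent of the previous sum, so the cross term has expectation 0.\<close>

lemma (in prob_space) second_moment_sum_indep:
  fixes Z :: "'i \<Rightarrow> 'a \<Rightarrow> real"
  assumes "finite I" "indep_vars (\<lambda>_. borel) Z I"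
    and "\<And>i. i \<in> I \<Longrightarrow> integrable M (Z i)"
    and "\<And>i. i \<in> I \<Longrightarrow> expectation (Z i) = 0"
    and "\<And>i. i \<in> I \<Longrightarrow> integrable M (\<lambda>\<omega>. (Z i \<omega>)\<^sup>2)"
  shows "integrable M (\<lambda>\<omega>. (\<Sum>i\<in>I. Z i \<omega>)\<^sup>2)"
    and "expectation (\<lambda>\<omega>. (\<Sum>i\<in>I. Z i \<omega>)\<^sup>2) = (\<Sum>i\<in>I. expectation (\<lambda>\<omega>. (Z i \<omega>)\<^sup>2))"
proof -
  have "integrable M (\<lambda>\<omega>. (\<Sum>i\<in>I. Z i \<omega>)\<^sup>2) \<and>
      expectation (\<lambda>\<omega>. (\<Sum>i\<in>I. Z i \<omega>)\<^sup>2) = (\<Sum>i\<in>I. expectation (\<lambda>\<omega>. (Z i \<omega>)\<^sup>2))"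
    using assms
  proof (induction I rule: finite_induct)
    case empty
    then show ?case by simp
  next
    case (insert i I)
    let ?S = "\<lambda>\<omega>. \<Sum>j\<in>I. Z j \<omega>"
    have IH: "integrable M (\<lambda>\<omega>. (?S \<omega>)\<^sup>2)"
        "expectation (\<lambda>\<omega>. (?S \<omega>)\<^sup>2) = (\<Sum>i\<in>I. expectation (\<lambda>\<omega>. (Z i \<omega>)\<^sup>2))"
      using insert.IH insert.prems indep_vars_subset[OF insert.prems(1), of I] by auto
    have ind: "indep_var borel (Z i) borel ?S"
      by (rule indep_vars_sum) (use insert in auto)
    have S: "integrable M ?S" using insert by auto
    have "expectation (\<lambda>\<omega>. Z i \<omega> * ?S \<omega>) = expectation (Z i) * expectation ?S"
      by (rule indep_var_lebesgue_integral) (use ind S insert in auto)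
    then have cross: "expectation (\<lambda>\<omega>. Z i \<omega> * ?S \<omega>) = 0"
      using insert by simp
    have intcross: "integrable M (\<lambda>\<omega>. Z i \<omega> * ?S \<omega>)"
      by (rule indep_var_integrable) (use ind S insert in auto)
    have expand: "(\<lambda>\<omega>. (\<Sum>j\<in>insert i I. Z j \<omega>)\<^sup>2)
        = (\<lambda>\<omega>. (Z i \<omega>)\<^sup>2 + (2 * (Z i \<omega> * ?S \<omega>) + (?S \<omega>)\<^sup>2))"
      using insert.hyps by (auto simp: fun_eq_iff power2_sum)
    have i2: "integrable M (\<lambda>\<omega>. (Z i \<omega>)\<^sup>2)" using insert by auto
    show ?case
      unfolding expand using insert.hyps i2 IH intcross cross by simp
  qed
  then show "integrable M (\<lambda>\<omega>. (\<Sum>i\<in>I. Z i \<omega>)\<^sup>2)"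
    "expectation (\<lambda>\<omega>. (\<Sum>i\<in>I. Z i \<omega>)\<^sup>2) = (\<Sum>i\<in>I. expectation (\<lambda>\<omega>. (Z i \<omega>)\<^sup>2))"
    by auto
qed

section \<open>Samples of independent identically distributed real variables\<close>

text \<open>Indices start at 1, as in \<open>emp_cdf\<close>, so nothing is said about
  \<open>W 0\<close>. By \<open>compose\<close> the locale is stable under Borel maps; its results
  therefore also apply to truncations, to indicators and to the reflected sample
  \<open>1 - W i\<close>.\<close>

locale iid_reals = prob_space M for M :: "'a measure" +
  fixes W :: "nat \<Rightarrow> 'a \<Rightarrow> real"
  assumes indep: "indep_vars (\<lambda>_. borel) W {1..}"
    and ident: "\<And>i. 1 \<le> i \<Longrightarrow> distr M borel (W i) = distr M borel (W 1)"
begin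

lemma rv [measurable]: "1 \<le> i \<Longrightarrow> random_variable borel (W i)"
  using indep unfolding indep_vars_def by auto

text \<open>Both forms are recorded because simplification may turn the index \<open>1\<close> into
  \<open>Suc 0\<close>.\<close>

lemma rv_1 [measurable]: "random_variable borel (W 1)" "random_variable borel (W (Suc 0))"
  using rv[of 1] by auto

lemma compose:
  assumes [measurable]: "g \<in> borel_measurable borel"
  shows "iid_reals M (\<lambda>i \<omega>. g (W i \<omega>))"
proof
  show "indep_vars (\<lambda>_. borel) (\<lambda>i \<omega>. g (W i \<omega>)) {1..}"
    by (rule indep_vars_compose2[OF indep]) simp
  fix i :: nat assume i: "1 \<le> i"
  have *: "distr M borel (\<lambda>\<omega>. g (W i \<omega>)) = distr (distr M borel (W i)) borel g" if "1 \<le> i" for i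
    using rv[OF that] by (subst distr_distr) (auto simp: comp_def)
  show "distr M borel (\<lambda>\<omega>. g (W i \<omega>)) = distr M borel (\<lambda>\<omega>. g (W 1 \<omega>))"
    using *[OF i] *[of 1] ident[OF i] by simp
qed

lemma prob_ident:
  assumes "1 \<le> i" "B \<in> sets borel"
  shows "prob {\<omega> \<in> space M. W i \<omega> \<in> B} = prob {\<omega> \<in> space M. W 1 \<omega> \<in> B}"
proof -
  have "prob {\<omega> \<in> space M. W i \<omega> \<in> B} = measure (distr M borel (W i)) B" if "1 \<le> i" for i
    using rv[OF that] assms(2) by (subst measure_distr) (auto intro: arg_cong[where f = prob])
  from this[OF assms(1)] this[of 1] ident[OF assms(1)] show ?thesis by simp
qed

lemma integral_ident:
  fixes g :: "real \<Rightarrow> real"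
  assumes i: "1 \<le> i" and g: "g \<in> borel_measurable borel"
  shows "integrable M (\<lambda>\<omega>. g (W i \<omega>)) \<longleftrightarrow> integrable M (\<lambda>\<omega>. g (W 1 \<omega>))"
    and "expectation (\<lambda>\<omega>. g (W i \<omega>)) = expectation (\<lambda>\<omega>. g (W 1 \<omega>))"
proof -
  have *: "integrable M (\<lambda>\<omega>. g (W i \<omega>)) \<longleftrightarrow> integrable (distr M borel (W i)) g"
      "expectation (\<lambda>\<omega>. g (W i \<omega>)) = integral\<^sup>L (distr M borel (W i)) g" if "1 \<le> i" for i
    using rv[OF that] g by (simp_all add: integrable_distr_eq integral_distr)
  show "integrable M (\<lambda>\<omega>. g (W i \<omega>)) \<longleftrightarrow> integrable M (\<lambda>\<omega>. g (W 1 \<omega>))"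
    "expectation (\<lambda>\<omega>. g (W i \<omega>)) = expectation (\<lambda>\<omega>. g (W 1 \<omega>))"
    using *[OF i] *[of 1] ident[OF i] by simp_all
qed

lemma AE_ident:
  assumes "{x. P x} \<in> sets borel" "AE \<omega> in M. P (W 1 \<omega>)"
  shows "AE \<omega> in M. \<forall>i\<ge>1. P (W i \<omega>)"
proof -
  have "AE \<omega> in M. P (W i \<omega>)" if i: "1 \<le> i" for i
  proof -
    have eq: "(AE \<omega> in M. P (W i \<omega>)) \<longleftrightarrow> (AE x in distr M borel (W i). P x)" if "1 \<le> i" for i
      using rv[OF that] assms(1) by (subst AE_distr_iff) auto
    show ?thesis
      unfolding eq[OF i] ident[OF i] using assms(2) unfolding eq[OF order_refl] .
  qed
  then show ?thesis unfolding AE_all_countable by auto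
qed

section \<open>A one-sided strong law along dyadic blocks\<close>

text \<open>A large block sum has one of two causes: some variable exceeds the block length, which a
  union bound covers, or the sum of the truncated centred variables deviates by at least
  \<open>2 ^ k * e\<close>, which Chebyshev's inequality covers.\<close>

lemma prob_truncated_mean:
  assumes nonneg: "\<And>i \<omega>. 0 \<le> W i \<omega>" and int: "integrable M (W 1)"
    and e: "0 < e" and a: "a = expectation (W 1) + e"
  shows "prob {\<omega> \<in> space M. 2 ^ k * a < (\<Sum>i=1..2 ^ k. W i \<omega>)}
    \<le> 2 ^ k * prob {\<omega> \<in> space M. 2 ^ k < W 1 \<omega>}
      + expectation (\<lambda>\<omega>. (W 1 \<omega>)\<^sup>2 / 2 ^ k * indicator {..2 ^ k} (W 1 \<omega>)) / e\<^sup>2"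
proof -
  define t where "t y = y * indicator {..2 ^ k} y" for y :: real
  define m where "m = expectation (\<lambda>\<omega>. t (W 1 \<omega>))"
  define z where "z y = t y - m" for y
  let ?I = "{1..2 ^ k :: nat}"
  let ?S = "\<lambda>\<omega>. \<Sum>i\<in>?I. z (W i \<omega>)"
  have [measurable]: "t \<in> borel_measurable borel" "z \<in> borel_measurable borel"
    unfolding t_def z_def by measurable
  have t_bound: "0 \<le> t (W i \<omega>)" "t (W i \<omega>) \<le> 2 ^ k" "t (W i \<omega>) \<le> W i \<omega>" for i \<omega>
    using nonneg[of i \<omega>] by (auto simp: t_def indicator_def)
  have int_t: "integrable M (\<lambda>\<omega>. t (W 1 \<omega>))"
    by (rule integrable_const_bound[where B = "2 ^ k"]) (use t_bound[of 1] in auto)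
  have int_t2: "integrable M (\<lambda>\<omega>. (t (W 1 \<omega>))\<^sup>2)"
    by (rule integrable_const_bound[where B = "(2 ^ k)\<^sup>2"]) (use t_bound[of 1] in \<open>auto intro: power_mono\<close>)
  have int_z: "integrable M (\<lambda>\<omega>. z (W 1 \<omega>))" "expectation (\<lambda>\<omega>. z (W 1 \<omega>)) = 0"
    unfolding z_def using int_t by (auto simp: m_def prob_space)
  have z2: "(\<lambda>\<omega>. (z (W 1 \<omega>))\<^sup>2) = (\<lambda>\<omega>. (t (W 1 \<omega>))\<^sup>2 - 2 * m * t (W 1 \<omega>) + m\<^sup>2)"
    by (auto simp: z_def power2_eq_square algebra_simps)
  have int_z2: "integrable M (\<lambda>\<omega>. (z (W 1 \<omega>))\<^sup>2)"
    unfolding z2 using int_t int_t2 by auto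
  have Ez2: "expectation (\<lambda>\<omega>. (z (W 1 \<omega>))\<^sup>2) \<le> expectation (\<lambda>\<omega>. (t (W 1 \<omega>))\<^sup>2)"
    unfolding z2 using int_t int_t2 by (simp add: m_def prob_space power2_eq_square)
  \<comment> \<open>Truncation lowers the mean of a nonnegative variable. This direction suffices
    for an upper bound on the sum.\<close>
  have m_le: "m \<le> expectation (W 1)"
    unfolding m_def by (rule integral_mono) (use int_t int t_bound in auto)
  interpret Z: iid_reals M "\<lambda>i \<omega>. z (W i \<omega>)" by (rule compose) simp
  have Zind: "indep_vars (\<lambda>_. borel) (\<lambda>i \<omega>. z (W i \<omega>)) ?I"
    by (rule indep_vars_subset[OF Z.indep]) auto
  have Zint: "integrable M (\<lambda>\<omega>. z (W i \<omega>))" "expectation (\<lambda>\<omega>. z (W i \<omega>)) = 0"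
      "integrable M (\<lambda>\<omega>. (z (W i \<omega>))\<^sup>2)"
      "expectation (\<lambda>\<omega>. (z (W i \<omega>))\<^sup>2) = expectation (\<lambda>\<omega>. (z (W 1 \<omega>))\<^sup>2)" if "i \<in> ?I" for i
    using that int_z int_z2 integral_ident[of i z] integral_ident[of i "\<lambda>y. (z y)\<^sup>2"] by auto
  note S2 = second_moment_sum_indep[OF _ Zind Zint(1-3)]
  have [measurable]: "?S \<in> borel_measurable M"
    using Zint(1) by (intro borel_measurable_sum) auto
  have ES: "expectation ?S = 0" using Zint by simp
  have e2: "0 < 2 ^ k * e" using e by simp
  have "prob {\<omega> \<in> space M. 2 ^ k * e \<le> \<bar>?S \<omega> - expectation ?S\<bar>} \<le> variance ?S / (2 ^ k * e)\<^sup>2"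
    by (rule Chebyshev_inequality) (use S2 e2 in auto)
  also have "variance ?S = 2 ^ k * expectation (\<lambda>\<omega>. (z (W 1 \<omega>))\<^sup>2)"
  proof -
    have "variance ?S = (\<Sum>i\<in>?I. expectation (\<lambda>\<omega>. (z (W i \<omega>))\<^sup>2))"
      unfolding ES diff_0_right by (rule S2(2)) auto
    also have "\<dots> = (\<Sum>i\<in>?I. expectation (\<lambda>\<omega>. (z (W 1 \<omega>))\<^sup>2))"
      by (rule sum.cong[OF refl Zint(4)])
    finally show ?thesis by simp
  qed
  also have "\<dots> / (2 ^ k * e)\<^sup>2 \<le> 2 ^ k * expectation (\<lambda>\<omega>. (t (W 1 \<omega>))\<^sup>2) / (2 ^ k * e)\<^sup>2"
    using Ez2 by (intro divide_right_mono mult_left_mono) auto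
  also have "\<dots> = expectation (\<lambda>\<omega>. (t (W 1 \<omega>))\<^sup>2 / 2 ^ k) / e\<^sup>2"
    by (simp add: field_simps power2_eq_square)
  also have "(\<lambda>\<omega>. (t (W 1 \<omega>))\<^sup>2 / 2 ^ k) = (\<lambda>\<omega>. (W 1 \<omega>)\<^sup>2 / 2 ^ k * indicator {..2 ^ k} (W 1 \<omega>))"
    by (auto simp: t_def indicator_def)
  finally have cheb: "prob {\<omega> \<in> space M. 2 ^ k * e \<le> \<bar>?S \<omega>\<bar>}
      \<le> expectation (\<lambda>\<omega>. (W 1 \<omega>)\<^sup>2 / 2 ^ k * indicator {..2 ^ k} (W 1 \<omega>)) / e\<^sup>2"
    unfolding ES by simp
  have sets_B: "{\<omega> \<in> space M. W i \<omega> \<in> {2 ^ k<..}} \<in> events" if "i \<in> ?I" for i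
  proof -
    have [measurable]: "random_variable borel (W i)" using rv that by simp
    show ?thesis by measurable
  qed
  have "{\<omega> \<in> space M. 2 ^ k * a < (\<Sum>i=1..2 ^ k. W i \<omega>)}
      \<subseteq> (\<Union>i\<in>?I. {\<omega> \<in> space M. W i \<omega> \<in> {2 ^ k<..}}) \<union> {\<omega> \<in> space M. 2 ^ k * e \<le> \<bar>?S \<omega>\<bar>}"
  proof (intro subsetI, rule ccontr)
    fix \<omega> assume 1: "\<omega> \<in> {\<omega> \<in> space M. 2 ^ k * a < (\<Sum>i=1..2 ^ k. W i \<omega>)}"
      and 2: "\<omega> \<notin> (\<Union>i\<in>?I. {\<omega> \<in> space M. W i \<omega> \<in> {2 ^ k<..}}) \<union> {\<omega> \<in> space M. 2 ^ k * e \<le> \<bar>?S \<omega>\<bar>}"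
    \<comment> \<open>Outside both exceptional events truncation changes no summand, and the centred
      sum stays below \<open>2 ^ k * e\<close>.\<close>
    have "(\<Sum>i\<in>?I. W i \<omega>) = (\<Sum>i\<in>?I. t (W i \<omega>))"
      by (rule sum.cong) (use 1 2 in \<open>auto simp: t_def not_less\<close>)
    also have "\<dots> = ?S \<omega> + 2 ^ k * m"
      by (simp add: z_def sum_subtractf)
    also have "\<dots> \<le> 2 ^ k * e + 2 ^ k * expectation (W 1)"
      using 1 2 m_le by (intro add_mono mult_left_mono) auto
    finally show False using 1 by (simp add: a algebra_simps)
  qed
  then have "prob {\<omega> \<in> space M. 2 ^ k * a < (\<Sum>i=1..2 ^ k. W i \<omega>)}
      \<le> prob ((\<Union>i\<in>?I. {\<omega> \<in> space M. W i \<omega> \<in> {2 ^ k<..}}) \<union> {\<omega> \<in> space M. 2 ^ k * e \<le> \<bar>?S \<omega>\<bar>})"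
    by (rule finite_measure_mono) (use sets_B in auto)
  also have "\<dots> \<le> prob (\<Union>i\<in>?I. {\<omega> \<in> space M. W i \<omega> \<in> {2 ^ k<..}}) + prob {\<omega> \<in> space M. 2 ^ k * e \<le> \<bar>?S \<omega>\<bar>}"
    by (rule measure_Un_le) (use sets_B in auto)
  also have "prob (\<Union>i\<in>?I. {\<omega> \<in> space M. W i \<omega> \<in> {2 ^ k<..}})
      \<le> (\<Sum>i\<in>?I. prob {\<omega> \<in> space M. W i \<omega> \<in> {2 ^ k<..}})"
    by (rule measure_UNION_le) (use sets_B in auto)
  also have "\<dots> = (\<Sum>i\<in>?I. prob {\<omega> \<in> space M. W 1 \<omega> \<in> {2 ^ k<..}})"
    by (rule sum.cong[OF refl], rule prob_ident) auto
  also have "\<dots> = 2 ^ k * prob {\<omega> \<in> space M. 2 ^ k < W 1 \<omega>}"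
    by simp
  finally show ?thesis using cheb by simp
qed

text \<open>The dyadic blocks are handled by truncating at the block length, which makes both error terms of
  \<open>prob_truncated_mean\<close> summable over the blocks; monotonicity in the number of summands costs
  the factor 2.\<close>

lemma AE_eventually_sum_le:
  assumes nonneg: "\<And>i \<omega>. 0 \<le> W i \<omega>" and int: "integrable M (W 1)"
    and less: "expectation (W 1) < a"
  shows "AE \<omega> in M. \<forall>\<^sub>F n in sequentially. (\<Sum>i=1..n. W i \<omega>) \<le> 2 * a * real n"
proof -
  define e where "e = a - expectation (W 1)"
  have e: "0 < e" "a = expectation (W 1) + e" using less by (auto simp: e_def)
  let ?A = "\<lambda>k. {\<omega> \<in> space M. 2 ^ k * a < (\<Sum>i=1..2 ^ k. W i \<omega>)}"
  have [measurable]: "(\<lambda>\<omega>. \<Sum>i=1..n. W i \<omega>) \<in> borel_measurable M" for n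
    by (intro borel_measurable_sum rv) auto
  have int1: "integrable M (\<lambda>\<omega>. 2 ^ k * indicator {2 ^ k<..} (W 1 \<omega>) :: real)" for k
    by (rule integrable_const_bound[where B = "2 ^ k"]) (auto simp: indicator_def)
  have int2: "integrable M (\<lambda>\<omega>. (W 1 \<omega>)\<^sup>2 / 2 ^ k * indicator {..2 ^ k} (W 1 \<omega>))" for k
    by (rule integrable_const_bound[where B = "(2 ^ k)\<^sup>2 / 2 ^ k"])
      (use nonneg[of 1] in \<open>auto simp: indicator_def intro!: divide_right_mono power_mono\<close>)
  have E1: "2 ^ k * prob {\<omega> \<in> space M. 2 ^ k < W 1 \<omega>}
      = expectation (\<lambda>\<omega>. 2 ^ k * indicator {2 ^ k<..} (W 1 \<omega>))" for k
  proof -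
    have "prob {\<omega> \<in> space M. 2 ^ k < W 1 \<omega>} = expectation (indicator {\<omega> \<in> space M. 2 ^ k < W 1 \<omega>})"
      by simp
    also have "\<dots> = expectation (\<lambda>\<omega>. indicator {2 ^ k<..} (W 1 \<omega>))"
      by (rule Bochner_Integration.integral_cong) (auto simp: indicator_def)
    finally show ?thesis by simp
  qed
  \<comment> \<open>Exchanging the finite sum with the expectation lets both dyadic estimates act
    pointwise, which gives a bound independent of \<open>K\<close>.\<close>
  have "summable (\<lambda>k. prob (?A k))"
  proof (rule summableI_nonneg_bounded)
    fix K
    have "(\<Sum>k<K. prob (?A k)) \<le> (\<Sum>k<K. expectation (\<lambda>\<omega>. 2 ^ k * indicator {2 ^ k<..} (W 1 \<omega>))
        + expectation (\<lambda>\<omega>. (W 1 \<omega>)\<^sup>2 / 2 ^ k * indicator {..2 ^ k} (W 1 \<omega>)) / e\<^sup>2)"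
      unfolding E1[symmetric] by (intro sum_mono prob_truncated_mean nonneg int e)
    also have "\<dots> = expectation (\<lambda>\<omega>. \<Sum>k<K. 2 ^ k * indicator {2 ^ k<..} (W 1 \<omega>))
        + expectation (\<lambda>\<omega>. \<Sum>k<K. (W 1 \<omega>)\<^sup>2 / 2 ^ k * indicator {..2 ^ k} (W 1 \<omega>)) / e\<^sup>2"
      by (simp only: sum.distrib sum_divide_distrib[symmetric] Bochner_Integration.integral_sum[OF int1]
        Bochner_Integration.integral_sum[OF int2])
    also have "\<dots> \<le> expectation (\<lambda>\<omega>. 2 * W 1 \<omega>) + expectation (\<lambda>\<omega>. 2 * W 1 \<omega>) / e\<^sup>2"
      using int int1 int2 sum_pow2_below sum_truncated_squares nonneg
      by (intro add_mono divide_right_mono integral_mono Bochner_Integration.integrable_sum) auto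
    finally show "(\<Sum>k<K. prob (?A k)) \<le> \<dots>" .
  qed simp
  then have "AE \<omega> in M. \<forall>\<^sub>F k in sequentially. \<omega> \<in> space M - ?A k"
    by (intro borel_cantelli_AE1) (auto simp: less_top[symmetric])
  then show ?thesis
  proof eventually_elim
    case (elim \<omega>)
    then obtain k0 where k0: "\<And>k. k \<ge> k0 \<Longrightarrow> (\<Sum>i=1..2 ^ k. W i \<omega>) \<le> 2 ^ k * a"
      by (auto simp: eventually_sequentially not_less)
    have a: "0 < a" using less Bochner_Integration.integral_nonneg[of M "W 1", OF nonneg] by linarith
    have "(\<Sum>i=1..n. W i \<omega>) \<le> 2 * a * real n" if n: "n \<ge> 2 ^ k0" for n
    proof -
      have "n > 0" using n by (metis gr0I le_zero_eq power_not_zero zero_neq_numeral)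
      then obtain k where k: "2 ^ k \<le> n" "n < 2 ^ (k + 1)"
        using ex_power_ivl1[of 2 n] by force
      have "(2::nat) ^ k0 < 2 ^ (k + 1)" using n k by linarith
      then have "k0 \<le> k + 1" using power_less_imp_less_exp[of "2::nat" k0 "k + 1"] by simp
      have "(\<Sum>i=1..n. W i \<omega>) \<le> (\<Sum>i=1..2 ^ (k + 1). W i \<omega>)"
        by (rule sum_mono2) (use k nonneg in auto)
      also have "\<dots> \<le> 2 ^ (k + 1) * a" using k0 \<open>k0 \<le> k + 1\<close> by blast
      also have "\<dots> = 2 * a * real (2 ^ k)" by simp
      also have "\<dots> \<le> 2 * a * real n"
        using a k(1) by (intro mult_left_mono) (auto simp del: of_nat_power)
      finally show ?thesis .
    qed
    then show ?case unfolding eventually_sequentially by blast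
  qed
qed

section \<open>Frequencies and uniform convergence of empirical distribution functions\<close>

text \<open>Indicators are bounded, so Hoeffding's inequality makes the deviation probabilities
  decay geometrically in \<open>n\<close>. The first Borel-Cantelli lemma then applies to every
  tolerance \<open>1 / real (Suc m)\<close>.\<close>

lemma AE_frequency_tendsto:
  assumes B: "B \<in> sets borel"
  shows "AE \<omega> in M. (\<lambda>n. (\<Sum>i=1..n. indicator B (W i \<omega>)) / real n)
    \<longlonglongrightarrow> measure (distr M borel (W 1)) B"
proof -
  interpret Z: iid_reals M "\<lambda>i \<omega>. indicator B (W i \<omega>) :: real"
    by (rule compose) (use B in measurable)
  let ?f = "\<lambda>n \<omega>. (\<Sum>i=1..n. indicator B (W i \<omega>)) / real n"
  define \<mu> where "\<mu> = expectation (\<lambda>\<omega>. indicator B (W 1 \<omega>) :: real)"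
  have mu: "\<mu> = measure (distr M borel (W 1)) B"
  proof -
    have "\<mu> = integral\<^sup>L (distr M borel (W 1)) (indicator B)"
      unfolding \<mu>_def by (rule integral_distr[symmetric]) (use B in auto)
    then show ?thesis using B by simp
  qed
  have meas [measurable]: "?f n \<in> borel_measurable M" for n
    using Z.rv by (intro borel_measurable_divide borel_measurable_sum) auto
  have "AE \<omega> in M. \<forall>\<^sub>F n in sequentially. \<bar>?f n \<omega> - \<mu>\<bar> < e" if e: "0 < e" for e
  proof -
    let ?A = "\<lambda>n. {\<omega> \<in> space M. e \<le> \<bar>?f n \<omega> - \<mu>\<bar>}"
    have bound: "prob (?A n) \<le> 2 * exp (- 2 * e\<^sup>2) ^ n" if n: "1 \<le> n" for n
    proof -
      interpret H: Hoeffding_ineq_iid M "{1..n}" "\<lambda>i \<omega>. indicator B (W i \<omega>)" "\<lambda>\<omega>. indicator B (W 1 \<omega>)" 0 1 \<mu>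
      proof unfold_locales
        show "indep_vars (\<lambda>_. borel) (\<lambda>i \<omega>. indicator B (W i \<omega>) :: real) {1..n}"
          by (rule indep_vars_subset[OF Z.indep]) auto
        show "distr M borel (\<lambda>\<omega>. indicator B (W i \<omega>) :: real)
            = distr M borel (\<lambda>\<omega>. indicator B (W 1 \<omega>))" if "i \<in> {1..n}" for i
          using that by (intro Z.ident) simp
        show "random_variable borel (\<lambda>\<omega>. indicator B (W 1 \<omega>) :: real)" by (rule Z.rv_1)
        show "AE \<omega> in M. (indicator B (W 1 \<omega>) :: real) \<in> {0..1}" by (simp add: indicator_def)
        show "\<mu> \<equiv> expectation (\<lambda>\<omega>. indicator B (W 1 \<omega>))" unfolding \<mu>_def .
      qed simp
      have "prob (?A n) \<le> 2 * exp (- 2 * real n * e\<^sup>2)"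
        using H.Hoeffding_ineq_abs_ge'[of e] e n by simp
      also have "- 2 * real n * e\<^sup>2 = real n * (- 2 * e\<^sup>2)" by simp
      finally show ?thesis unfolding exp_of_nat_mult .
    qed
    have "summable (\<lambda>n. 2 * exp (- 2 * e\<^sup>2) ^ n)"
      using e by (intro summable_mult summable_geometric) auto
    then have "summable (\<lambda>n. prob (?A n))"
      by (rule summable_comparison_test'[where N = 1]) (use bound in auto)
    then have "AE \<omega> in M. \<forall>\<^sub>F n in sequentially. \<omega> \<in> space M - ?A n"
      by (intro borel_cantelli_AE1) (auto simp: less_top[symmetric])
    then show ?thesis
    proof eventually_elim
      case (elim \<omega>)
      then show ?case by eventually_elim auto
    qed
  qed
  then have "AE \<omega> in M. \<forall>m. \<forall>\<^sub>F n in sequentially. \<bar>?f n \<omega> - \<mu>\<bar> < 1 / real (Suc m)"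
    unfolding AE_all_countable by auto
  then show ?thesis
  proof eventually_elim
    case (elim \<omega>)
    have "\<forall>\<^sub>F n in sequentially. dist (?f n \<omega>) \<mu> < e" if "0 < e" for e
    proof -
      obtain m where m: "1 / real (Suc m) < e" using nat_approx_posE[OF \<open>0 < e\<close>] .
      from elim[rule_format, of m] show ?thesis
        by eventually_elim (use m in \<open>simp add: dist_real_def\<close>)
    qed
    then show ?case unfolding mu[symmetric] by (rule tendstoI)
  qed
qed

lemma Glivenko_Cantelli:
  "AE \<omega> in M. \<forall>e>0. \<forall>\<^sub>F n in sequentially. \<forall>x. \<bar>emp_cdf W n \<omega> x - cdf (distr M borel (W 1)) x\<bar> \<le> e"
proof -
  interpret D: cdf_distribution "distr M borel (W 1)"
    unfolding cdf_distribution_def by simp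
  let ?F = "cdf (distr M borel (W 1))"
  let ?f = "\<lambda>B n \<omega>. (\<Sum>i=1..n. indicator B (W i \<omega>)) / real n"
  \<comment> \<open>comparing at the \<open>j/m\<close>-quantiles and their left limits bounds the error by \<open>1/m\<close> everywhere\<close>
  define q where "q j m = D.I (real j / real m)" for j m :: nat
  have "AE \<omega> in M. \<forall>j m. (\<lambda>n. ?f {..q j m} n \<omega>) \<longlonglongrightarrow> ?F (q j m)"
    unfolding AE_all_countable cdf_def by (intro allI AE_frequency_tendsto) simp
  moreover have "AE \<omega> in M. \<forall>j m. (\<lambda>n. ?f {..<q j m} n \<omega>) \<longlonglongrightarrow> measure (distr M borel (W 1)) {..<q j m}"
    unfolding AE_all_countable by (intro allI AE_frequency_tendsto) simp
  ultimately show ?thesis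
  proof eventually_elim
    case (elim \<omega>)
    show ?case
    proof (intro allI impI)
      fix e :: real assume "0 < e"
      then obtain k where "1 / real (Suc k) < e / 2" using nat_approx_posE[of "e / 2"] by auto
      then obtain m :: nat where m: "0 < m" "1 / real m < e / 2" by blast
      have "\<forall>\<^sub>F n in sequentially. \<forall>j\<in>{..<m}. \<bar>?f {..q j m} n \<omega> - ?F (q j m)\<bar> < e / 2"
        unfolding dist_real_def[symmetric] using elim(1) \<open>0 < e\<close>
        by (intro eventually_ball_finite ballI tendstoD) auto
      moreover have "\<forall>\<^sub>F n in sequentially. \<forall>j\<in>{..<m}.
          \<bar>?f {..<q j m} n \<omega> - measure (distr M borel (W 1)) {..<q j m}\<bar> < e / 2"
        unfolding dist_real_def[symmetric] using elim(2) \<open>0 < e\<close>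
        by (intro eventually_ball_finite ballI tendstoD) auto
      ultimately show "\<forall>\<^sub>F n in sequentially. \<forall>x. \<bar>emp_cdf W n \<omega> x - ?F x\<bar> \<le> e"
      proof eventually_elim
        case (elim n)
        show ?case
        proof
          fix x
          have emp: "emp_cdf W n \<omega> x = ?f {..x} n \<omega>"
            by (simp add: emp_cdf_def)
          have mono: "?f A n \<omega> \<le> ?f B n \<omega>" if "A \<subseteq> B" for A B :: "real set"
            using that by (intro divide_right_mono sum_mono) (auto simp: indicator_def)
          have "?f {..x} n \<omega> \<le> ?f UNIV n \<omega>" by (rule mono) simp
          also have "\<dots> \<le> 1" by simp
          finally have le1: "?f {..x} n \<omega> \<le> 1" .
          have ge0: "0 \<le> ?f {..x} n \<omega>" by (auto intro!: divide_nonneg_nonneg sum_nonneg)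
          have F01: "0 \<le> ?F x" "?F x \<le> 1" using D.cdf_nonneg D.cdf_bounded_prob by auto
          have upper: "?f {..x} n \<omega> \<le> ?F x + e"
          proof -
            \<comment> \<open>The least integer above \<open>real m * ?F x\<close>: then
              \<open>x\<close> lies strictly to the left of \<open>q j m\<close>, while
              \<open>j/m\<close> exceeds \<open>?F x\<close> by at most \<open>1/m\<close>. If
              \<open>j\<close> reaches \<open>m\<close>, the claim is trivial because frequencies
              are at most 1.\<close>
            define j where "j = Suc (nat \<lfloor>real m * ?F x\<rfloor>)"
            have j: "real m * ?F x < real j" "real j \<le> real m * ?F x + 1"
              unfolding j_def using F01 m by (auto simp: of_nat_nat) linarith+
            have j': "?F x < real j / real m" "real j / real m \<le> ?F x + 1 / real m"
              using j m by (auto simp: field_simps)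
            show ?thesis
            proof (cases "j < m")
              case True
              have jm: "0 < real j / real m" "real j / real m < 1"
                using True m by (auto simp: j_def)
              have below: "?F y < real j / real m" if "y < q j m" for y
                using D.pseudoinverse[OF jm, of y] that by (auto simp: q_def not_le[symmetric])
              have "x < q j m"
                using D.pseudoinverse[OF jm, of x] j' by (auto simp: q_def)
              then have "?f {..x} n \<omega> \<le> ?f {..<q j m} n \<omega>" by (intro mono) auto
              also have "\<dots> \<le> measure (distr M borel (W 1)) {..<q j m} + e / 2"
                using bspec[OF elim(2), of j, unfolded lessThan_iff, OF True] by linarith
              \<comment> \<open>The mass strictly below \<open>q j m\<close> is the left limit of
                the distribution function there, and to the left of this point the function stays
                below \<open>j/m\<close>.\<close>
              also have "measure (distr M borel (W 1)) {..<q j m} \<le> real j / real m"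
                by (rule tendsto_upperbound[OF D.cdf_at_left])
                  (use below in \<open>auto simp: eventually_at_filter intro!: always_eventually less_imp_le\<close>)
              finally show ?thesis using j' m by linarith
            next
              case False
              then have "1 \<le> real j / real m" using m by (simp add: field_simps)
              with le1 j' m \<open>0 < e\<close> show ?thesis by linarith
            qed
          qed
          have lower: "?F x - e \<le> ?f {..x} n \<omega>"
          proof (cases "real m * ?F x \<le> 1")
            case True
            then have "?F x \<le> 1 / real m" using m by (simp add: field_simps)
            with ge0 m \<open>0 < e\<close> show ?thesis by linarith
          next
            case False
            \<comment> \<open>The largest integer strictly below \<open>real m * ?F x\<close>.
              Strictness gives \<open>j < m\<close> even when \<open>?F x = 1\<close>, so the level
              \<open>j/m\<close> stays inside the open unit interval, where the pseudoinverse is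
              characterised.\<close>
            define j where "j = nat (\<lceil>real m * ?F x\<rceil> - 1)"
            have j: "real j < real m * ?F x" "real m * ?F x \<le> real j + 1" "1 \<le> j"
              unfolding j_def using False by linarith+
            have j': "real j / real m < ?F x" "?F x \<le> real j / real m + 1 / real m"
              using j m by (auto simp: field_simps)
            have "real m * ?F x \<le> real m" using F01 by (simp add: mult_left_le)
            with j have "j < m" by linarith
            then have jm: "0 < real j / real m" "real j / real m < 1" "j < m"
              using j m by auto
            have "q j m \<le> x" using D.pseudoinverse[OF jm(1,2), of x] j' by (auto simp: q_def)
            then have "?f {..q j m} n \<omega> \<le> ?f {..x} n \<omega>" by (intro mono) auto
            moreover have "?F (q j m) - e / 2 \<le> ?f {..q j m} n \<omega>"
              using bspec[OF elim(1), of j, unfolded lessThan_iff, OF jm(3)] by linarith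
            moreover have "real j / real m \<le> ?F (q j m)"
              using D.pseudoinverse[OF jm(1,2), of "q j m"] by (simp add: q_def)
            ultimately show ?thesis using j' m by linarith
          qed
          show "\<bar>emp_cdf W n \<omega> x - ?F x\<bar> \<le> e"
            unfolding emp using upper lower by linarith
        qed
      qed
    qed
  qed
qed

section \<open>Empirical distribution functions near the endpoint 0\<close>

text \<open>For \<open>0 < w \<le> x < d\<close> one has
  \<open>1 \<le> x powr p * w powr (- p)\<close>. The average of \<open>w powr (- p)\<close> over
  the values up to \<open>d\<close> is eventually small by the strong law, since its expectation
  tends to 0 with \<open>d\<close> by dominated convergence. Only countably many thresholds are
  used, so one null set serves all \<open>e\<close>.\<close>

lemma AE_emp_cdf_le_powr:
  assumes p: "0 < p" and pos: "AE \<omega> in M. 0 < W 1 \<omega>"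
    and int: "integrable M (\<lambda>\<omega>. W 1 \<omega> powr (- p))"
  shows "AE \<omega> in M. \<forall>e>0. \<exists>d>0. \<forall>\<^sub>F n in sequentially. \<forall>x. 0 < x \<and> x < d \<longrightarrow>
    emp_cdf W n \<omega> x \<le> e * x powr p"
proof -
  define g where "g k w = w powr (- p) * indicator {0<..1 / real (Suc k)} w" for k w
  have [measurable]: "g k \<in> borel_measurable borel" for k unfolding g_def by measurable
  have g_nonneg: "0 \<le> g k w" for k w by (simp add: g_def)
  have g_le: "g k w \<le> w powr (- p)" for k w by (simp add: g_def indicator_def)
  have int_g: "integrable M (\<lambda>\<omega>. g k (W 1 \<omega>))" for k
    by (rule Bochner_Integration.integrable_bound[OF int]) (use g_nonneg g_le in auto)
  have "(\<lambda>k. expectation (\<lambda>\<omega>. g k (W 1 \<omega>))) \<longlonglongrightarrow> expectation (\<lambda>\<omega>. 0)"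
  proof (rule integral_dominated_convergence[where w = "\<lambda>\<omega>. W 1 \<omega> powr (- p)"])
    show "AE \<omega> in M. (\<lambda>k. g k (W 1 \<omega>)) \<longlonglongrightarrow> 0"
      using pos
    proof eventually_elim
      case (elim \<omega>)
      then obtain N where N: "1 / real (Suc N) < W 1 \<omega>" using nat_approx_posE by blast
      have "g k (W 1 \<omega>) = 0" if "N \<le> k" for k
      proof -
        have "1 / real (Suc k) \<le> 1 / real (Suc N)" using that by (intro divide_left_mono) auto
        with N show ?thesis by (auto simp: g_def)
      qed
      then show ?case by (intro tendsto_eventually) (auto simp: eventually_sequentially)
    qed
  qed (use int g_nonneg g_le in auto)
  then have lim: "(\<lambda>k. expectation (\<lambda>\<omega>. g k (W 1 \<omega>))) \<longlonglongrightarrow> 0" by simp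
  have "\<exists>k. expectation (\<lambda>\<omega>. g k (W 1 \<omega>)) < 1 / real (Suc m)" for m
    using order_tendstoD(2)[OF lim, of "1 / real (Suc m)"] by (auto simp: eventually_sequentially)
  then obtain \<kappa> where \<kappa>: "\<And>m. expectation (\<lambda>\<omega>. g (\<kappa> m) (W 1 \<omega>)) < 1 / real (Suc m)"
    by metis
  have "AE \<omega> in M. \<forall>m. \<forall>\<^sub>F n in sequentially.
      (\<Sum>i=1..n. g (\<kappa> m) (W i \<omega>)) \<le> 2 * (1 / real (Suc m)) * real n"
  proof (unfold AE_all_countable, rule allI)
    fix m
    interpret Z: iid_reals M "\<lambda>i \<omega>. g (\<kappa> m) (W i \<omega>)" by (rule compose) simp
    show "AE \<omega> in M. \<forall>\<^sub>F n in sequentially.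
      (\<Sum>i=1..n. g (\<kappa> m) (W i \<omega>)) \<le> 2 * (1 / real (Suc m)) * real n"
      by (rule Z.AE_eventually_sum_le) (use g_nonneg int_g \<kappa> in auto)
  qed
  \<comment> \<open>Since \<open>0 powr (- p) = 0\<close>, the function \<open>g\<close> would not
    count sample values equal to 0; these are excluded almost surely.\<close>
  moreover have "AE \<omega> in M. \<forall>i\<ge>1. 0 < W i \<omega>"
    by (rule AE_ident) (use pos in auto)
  ultimately show ?thesis
  proof eventually_elim
    case (elim \<omega>)
    show ?case
    proof (intro allI impI)
      fix e :: real assume "0 < e"
      \<comment> \<open>Half of \<open>e\<close> absorbs the factor 2 lost in the strong
        law.\<close>
      then obtain m where m: "1 / real (Suc m) < e / 2" using nat_approx_posE[of "e / 2"] by auto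
      define d where "d = 1 / real (Suc (\<kappa> m))"
      have "\<forall>\<^sub>F n in sequentially. \<forall>x. 0 < x \<and> x < d \<longrightarrow> emp_cdf W n \<omega> x \<le> e * x powr p"
        using elim(1)[rule_format, of m] eventually_gt_at_top[of 0]
      proof eventually_elim
        case (elim n)
        show ?case
        proof (intro allI impI)
          fix x assume x: "0 < x \<and> x < d"
          have "indicator {..x} (W i \<omega>) \<le> x powr p * g (\<kappa> m) (W i \<omega>)" if i: "i \<in> {1..n}" for i
          proof (cases "W i \<omega> \<le> x")
            case True
            have w: "0 < W i \<omega>" using \<open>\<forall>i\<ge>1. 0 < W i \<omega>\<close> i by auto
            have "1 = W i \<omega> powr p * W i \<omega> powr (- p)"
              using w by (simp add: powr_add[symmetric])
            also have "\<dots> \<le> x powr p * W i \<omega> powr (- p)"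
              using w True p by (intro mult_right_mono powr_mono2) auto
            also have "\<dots> = x powr p * g (\<kappa> m) (W i \<omega>)"
              using w True x by (auto simp: g_def d_def)
            finally show ?thesis using True by simp
          qed (use g_nonneg in auto)
          then have "(\<Sum>i=1..n. indicator {..x} (W i \<omega>)) \<le> (\<Sum>i=1..n. x powr p * g (\<kappa> m) (W i \<omega>))"
            by (rule sum_mono)
          also have "\<dots> = x powr p * (\<Sum>i=1..n. g (\<kappa> m) (W i \<omega>))"
            by (simp add: sum_distrib_left)
          also have "\<dots> \<le> x powr p * (2 * (1 / real (Suc m)) * real n)"
            using elim(1) by (intro mult_left_mono) auto
          also have "\<dots> \<le> x powr p * (e * real n)"
            using m by (intro mult_left_mono mult_right_mono) auto
          finally show "emp_cdf W n \<omega> x \<le> e * x powr p"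
            using elim(2) by (simp add: emp_cdf_def field_simps)
        qed
      qed
      moreover have "0 < d" by (simp add: d_def)
      ultimately show "\<exists>d>0. \<forall>\<^sub>F n in sequentially. \<forall>x. 0 < x \<and> x < d \<longrightarrow> emp_cdf W n \<omega> x \<le> e * x powr p"
        by blast
    qed
  qed
qed

section \<open>The second Borel-Cantelli lemma\<close>

text \<open>By independence the probability of avoiding the sets from \<open>N\<close> on is at most
  a product of factors \<open>1 - \<pi> n\<close>, hence at most the exponential of minus any
  partial sum. Were it positive, its logarithm would bound the partial sums and the series would
  converge.\<close>

lemma AE_infinitely_often:
  assumes B [measurable]: "\<And>n. B n \<in> sets borel"
    and div: "\<not> summable (\<lambda>n. prob {\<omega> \<in> space M. W 1 \<omega> \<in> B n})"
  shows "AE \<omega> in M. \<exists>\<^sub>F n in sequentially. W n \<omega> \<in> B n"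
proof -
  define \<pi> where "\<pi> n = prob {\<omega> \<in> space M. W 1 \<omega> \<in> B n}" for n
  have pi: "0 \<le> \<pi> n" "\<pi> n \<le> 1" for n by (auto simp: \<pi>_def)
  have "AE \<omega> in M. \<exists>n\<ge>N. W n \<omega> \<in> B n" if N: "1 \<le> N" for N
  proof -
    let ?E = "\<lambda>K. {\<omega> \<in> space M. \<forall>n\<in>{N..<N + K}. W n \<omega> \<notin> B n}"
    let ?E' = "{\<omega> \<in> space M. \<forall>n\<ge>N. W n \<omega> \<notin> B n}"
    have compl: "{\<omega> \<in> space M. W n \<omega> \<in> - B n} \<in> events" if "n \<ge> N" for n
    proof -
      have [measurable]: "random_variable borel (W n)" using rv that N by simp
      show ?thesis by measurable
    qed
    have E': "?E' = (\<Inter>n\<in>{N..}. {\<omega> \<in> space M. W n \<omega> \<in> - B n})" by auto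
    have "?E' \<in> events"
      unfolding E' using compl by (intro sets.countable_INT') auto
    have prob_E: "prob (?E K) = (\<Prod>n\<in>{N..<N + K}. 1 - \<pi> n)" for K
    \<comment> \<open>The product rule needs a nonempty index set; for \<open>K = 0\<close> the
      event is the whole space.\<close>
    proof (cases "K = 0")
      case False
      have "?E K = (\<Inter>n\<in>{N..<N + K}. W n -` (- B n) \<inter> space M)"
        using False by auto
      also have "prob \<dots> = (\<Prod>n\<in>{N..<N + K}. prob (W n -` (- B n) \<inter> space M))"
        by (rule indep_varsD[OF indep]) (use N False in auto)
      also have "\<dots> = (\<Prod>n\<in>{N..<N + K}. 1 - \<pi> n)"
      proof (rule prod.cong[OF refl])
        fix n assume n: "n \<in> {N..<N + K}"
        have [measurable]: "random_variable borel (W n)" using rv n N by simp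
        have "W n -` (- B n) \<inter> space M = space M - {\<omega> \<in> space M. W n \<omega> \<in> B n}" by auto
        also have "prob \<dots> = 1 - prob {\<omega> \<in> space M. W n \<omega> \<in> B n}"
          by (rule prob_compl) measurable
        also have "prob {\<omega> \<in> space M. W n \<omega> \<in> B n} = \<pi> n"
          unfolding \<pi>_def by (rule prob_ident) (use n N in auto)
        finally show "prob (W n -` (- B n) \<inter> space M) = 1 - \<pi> n" .
      qed
      finally show ?thesis .
    qed (simp add: prob_space)
    have bound: "prob ?E' \<le> exp (- (\<Sum>n<K. \<pi> (n + N)))" for K
    proof -
      have "prob ?E' \<le> prob (?E K)"
      proof (rule finite_measure_mono)
        have "?E K = space M \<inter> (\<Inter>n\<in>{N..<N + K}. {\<omega> \<in> space M. W n \<omega> \<in> - B n})" by auto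
        also have "\<dots> \<in> events" using compl by (cases "K = 0") (auto intro!: sets.Int sets.finite_INT)
        finally show "?E K \<in> events" .
      qed auto
      also have "\<dots> \<le> (\<Prod>n\<in>{N..<N + K}. exp (- \<pi> n))"
        unfolding prob_E
      proof (rule prod_mono)
        fix n
        show "0 \<le> 1 - \<pi> n \<and> 1 - \<pi> n \<le> exp (- \<pi> n)"
          using pi[of n] exp_ge_add_one_self[of "- \<pi> n"] by simp
      qed
      also have "\<dots> = exp (- (\<Sum>n\<in>{N..<N + K}. \<pi> n))"
        by (simp add: exp_sum flip: sum_negf)
      also have "(\<Sum>n\<in>{N..<N + K}. \<pi> n) = (\<Sum>n<K. \<pi> (n + N))"
        using sum.shift_bounds_nat_ivl[of \<pi> 0 N K] by (simp add: add.commute atLeast0LessThan)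
      finally show ?thesis .
    qed
    have "prob ?E' = 0"
    proof (rule ccontr)
      assume "prob ?E' \<noteq> 0"
      then have posE: "0 < prob ?E'" by (simp add: less_le)
      have "(\<Sum>n<K. \<pi> (n + N)) \<le> - ln (prob ?E')" for K
        using ln_mono[OF bound[of K] posE] by simp
      then have "summable (\<lambda>n. \<pi> (n + N))"
        by (intro summableI_nonneg_bounded) (use pi in auto)
      with div show False unfolding \<pi>_def[symmetric] by (simp add: summable_iff_shift)
    qed
    then have "AE \<omega> in M. \<omega> \<notin> ?E'"
      using prob_eq_0[OF \<open>?E' \<in> events\<close>] by blast
    moreover have "AE \<omega> in M. \<omega> \<in> space M" by simp
    ultimately show ?thesis by eventually_elim auto
  qed
  \<comment> \<open>Tails begin at \<open>Suc N\<close> because the index 0 lies outside the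
    sample.\<close>
  then have "AE \<omega> in M. \<forall>N. \<exists>n\<ge>Suc N. W n \<omega> \<in> B n"
    unfolding AE_all_countable by simp
  then show ?thesis
  proof eventually_elim
    case (elim \<omega>)
    show ?case
      unfolding frequently_sequentially
    proof
      fix N
      from elim[rule_format, of N] obtain n where "Suc N \<le> n" "W n \<omega> \<in> B n" by auto
      then show "\<exists>n\<ge>N. W n \<omega> \<in> B n" by (intro exI[of _ n]) auto
    qed
  qed
qed

end

section \<open>Infinitely many small values\<close>

text \<open>The \<open>n\<close>-th indicator tests whether \<open>c * real (Suc n)\<close> is below
  \<open>w powr (- p)\<close>, so the series counts the multiples of \<open>c\<close> below this
  value and misses it by at most \<open>c\<close>. The inverse is taken in \<open>ennreal\<close> so
  that it is infinite at \<open>w = 0\<close>, where every indicator equals 1.\<close>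

lemma inverse_powr_le_suminf:
  fixes w c p :: real
  assumes w: "0 \<le> w" and c: "0 < c" and p: "0 < p"
  shows "inverse (ennreal (w powr p)) \<le> ennreal c
    + (\<Sum>n. ennreal (c * indicator {..<(1 / (c * real (Suc n))) powr (1 / p)} w))"
    (is "_ \<le> _ + suminf ?h")
proof -
  have count: "ennreal (c * real N) \<le> suminf ?h"
    if "\<And>n. n < N \<Longrightarrow> w < (1 / (c * real (Suc n))) powr (1 / p)" for N
  proof -
    have "(\<Sum>n<N. ?h n) = (\<Sum>n<N. ennreal c)"
      by (rule sum.cong) (use that in auto)
    also have "\<dots> = ennreal (c * real N)"
      using c by (simp add: ennreal_mult' ennreal_of_nat_eq_real_of_nat mult.commute)
    finally show ?thesis
      using sum_le_suminf[of ?h "{..<N}"] by simp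
  qed
  show ?thesis
  proof (cases "w = 0")
    case True
    have "suminf ?h = \<top>"
    proof (rule ccontr)
      assume "suminf ?h \<noteq> \<top>"
      then obtain t where t: "0 \<le> t" "suminf ?h = ennreal t" by (cases "suminf ?h") auto
      obtain N :: nat where "t / c < real N" using reals_Archimedean2 by blast
      then have "t < c * real N" using c by (simp add: field_simps)
      moreover have "ennreal (c * real N) \<le> ennreal t"
        unfolding t(2)[symmetric] using True c by (intro count) auto
      ultimately show False using t(1) c by (simp add: ennreal_le_iff)
    qed
    then show ?thesis by simp
  next
    case False
    with w have w: "0 < w" by simp
    define y where "y = w powr (- p)"
    have y: "0 < y" "w powr p = 1 / y" using w by (simp_all add: y_def powr_minus field_simps)
    \<comment> \<open>The number of positive multiples of \<open>c\<close> strictly below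
      \<open>y\<close>; the remainder is at most \<open>c\<close>.\<close>
    define N where "N = nat (\<lceil>y / c\<rceil> - 1)"
    have "0 < y / c" using y c by simp
    then have "real N < y / c" "y / c \<le> real N + 1" unfolding N_def by linarith+
    then have N: "c * real N < y" "y \<le> c + c * real N" using c by (simp_all add: field_simps)
    have "ennreal (c * real N) \<le> suminf ?h"
    proof (rule count)
      fix n assume "n < N"
      then have "c * real (Suc n) \<le> c * real N" using c by (intro mult_left_mono) auto
      then have less: "c * real (Suc n) < y" using N by linarith
      have "w powr p < 1 / (c * real (Suc n))"
        unfolding y(2) by (rule divide_strict_left_mono) (use less c y in auto)
      then have "(w powr p) powr (1 / p) < (1 / (c * real (Suc n))) powr (1 / p)"
        using p by (intro powr_less_mono2) auto
      then show "w < (1 / (c * real (Suc n))) powr (1 / p)"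
        using w p by (simp add: powr_powr)
    qed
    then have "ennreal c + ennreal (c * real N) \<le> ennreal c + suminf ?h"
      by (rule add_left_mono)
    moreover have "inverse (ennreal (w powr p)) \<le> ennreal c + ennreal (c * real N)"
      using y c N by (simp add: inverse_ennreal ennreal_plus[symmetric] del: ennreal_plus)
    ultimately show ?thesis by (rule order.trans[rotated])
  qed
qed

text \<open>Integrating the preceding bound shows that summable probabilities would make the
  expectation finite. So the series of probabilities diverges and the second Borel-Cantelli lemma
  applies.\<close>

lemma (in iid_reals) AE_infinitely_often_small:
  assumes p: "0 < p" and c: "0 < c" and nonneg: "AE \<omega> in M. 0 \<le> W 1 \<omega>"
    and inf: "(\<integral>\<^sup>+\<omega>. inverse (ennreal (W 1 \<omega> powr p)) \<partial>M) = \<infinity>"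
  shows "AE \<omega> in M. \<exists>\<^sub>F n in sequentially. W n \<omega> < (1 / (c * real n)) powr (1 / p)"
proof -
  define B where "B n = {..<(1 / (c * real n)) powr (1 / p)}" for n :: nat
  have [measurable]: "B n \<in> sets borel" for n by (simp add: B_def)
  define \<pi> where "\<pi> n = prob {\<omega> \<in> space M. W 1 \<omega> \<in> B n}" for n
  have "\<not> summable \<pi>"
  proof
    assume "summable \<pi>"
    then have summ: "summable (\<lambda>n. c * \<pi> (Suc n))"
      by (simp add: summable_Suc_iff)
    have piece: "(\<integral>\<^sup>+\<omega>. ennreal (c * indicator (B n) (W 1 \<omega>)) \<partial>M) = ennreal (c * \<pi> n)" for n
    proof -
      have "(\<integral>\<^sup>+\<omega>. ennreal (c * indicator (B n) (W 1 \<omega>)) \<partial>M)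
          = (\<integral>\<^sup>+\<omega>. ennreal c * indicator {\<omega> \<in> space M. W 1 \<omega> \<in> B n} \<omega> \<partial>M)"
        by (rule nn_integral_cong) (auto simp: indicator_def)
      also have "\<dots> = ennreal c * emeasure M {\<omega> \<in> space M. W 1 \<omega> \<in> B n}"
        by (rule nn_integral_cmult_indicator) measurable
      also have "\<dots> = ennreal (c * \<pi> n)"
        using c by (simp add: \<pi>_def emeasure_eq_measure ennreal_mult')
      finally show ?thesis .
    qed
    have "(\<integral>\<^sup>+\<omega>. inverse (ennreal (W 1 \<omega> powr p)) \<partial>M)
        \<le> (\<integral>\<^sup>+\<omega>. ennreal c + (\<Sum>n. ennreal (c * indicator (B (Suc n)) (W 1 \<omega>))) \<partial>M)"
      by (rule nn_integral_mono_AE, use nonneg in eventually_elim)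
        (use inverse_powr_le_suminf c p in \<open>simp add: B_def\<close>)
    also have "\<dots> = ennreal c + (\<Sum>n. \<integral>\<^sup>+\<omega>. ennreal (c * indicator (B (Suc n)) (W 1 \<omega>)) \<partial>M)"
      by (subst nn_integral_add) (auto simp: nn_integral_suminf emeasure_space_1)
    also have "\<dots> = ennreal c + ennreal (\<Sum>n. c * \<pi> (Suc n))"
      unfolding piece using c summ by (subst suminf_ennreal2) (auto simp: \<pi>_def)
    also have "\<dots> < \<infinity>" by (simp add: less_top[symmetric])
    finally show False using inf by simp
  qed
  then have "AE \<omega> in M. \<exists>\<^sub>F n in sequentially. W n \<omega> \<in> B n"
    unfolding \<pi>_def by (intro AE_infinitely_often) simp_all
  then show ?thesis by (simp add: B_def)
qed

section \<open>Uniform convergence of the weighted powers\<close>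

text \<open>Mean value theorem: the derivative \<open>s * z powr (s - 1)\<close> is at most
  \<open>s\<close> on the unit interval.\<close>

lemma powr_diff_le:
  fixes u v s :: real
  assumes "0 \<le> u" "u \<le> 1" "0 \<le> v" "v \<le> 1" "1 \<le> s"
  shows "\<bar>u powr s - v powr s\<bar> \<le> s * \<bar>u - v\<bar>"
proof -
  have *: "b powr s - a powr s \<le> s * (b - a)" if ab: "0 \<le> a" "a < b" "b \<le> 1" for a b
  proof -
    have "\<exists>l z. a < z \<and> z < b \<and> DERIV (\<lambda>x. x powr s) z :> l \<and> b powr s - a powr s = (b - a) * l"
    proof (rule MVT)
      show "continuous_on {a..b} (\<lambda>x. x powr s)"
        using ab assms by (intro continuous_on_powr') (auto intro: continuous_intros)
      show "(\<lambda>x. x powr s) differentiable (at x)" if "a < x" "x < b" for x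
        using has_real_derivative_powr[of x s] that ab
        by (auto simp: real_differentiable_def)
    qed fact
    then obtain l z where z: "a < z" "z < b" "DERIV (\<lambda>x. x powr s) z :> l"
      "b powr s - a powr s = (b - a) * l" by blast
    have "l = s * z powr (s - 1)"
      using DERIV_unique[OF z(3) has_real_derivative_powr] z(1) ab by simp
    also have "\<dots> \<le> s * 1"
      using z ab assms by (intro mult_left_mono powr_le1) auto
    finally have "(b - a) * l \<le> (b - a) * s" using ab by (intro mult_left_mono) auto
    with z(4) show ?thesis by (simp add: mult.commute)
  qed
  consider "u < v" | "u = v" | "v < u" by linarith
  then show ?thesis
  proof cases
    case 1
    then have "u powr s \<le> v powr s" using assms by (intro powr_mono2) auto
    with *[of u v] 1 assms show ?thesis by simp
  next
    case 3
    then have "v powr s \<le> u powr s" using assms by (intro powr_mono2) auto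
    with *[of v u] 3 assms show ?thesis by simp
  qed simp
qed

text \<open>The exponent \<open>(s - 1) / s\<close> is the one whose \<open>s\<close>-th power
  cancels the weight \<open>x powr (1 - s)\<close>.\<close>

lemma powr_quotient_le:
  fixes u x e s :: real
  assumes "0 \<le> u" "u \<le> e powr (1 / s) * x powr ((s - 1) / s)" "0 < x" "0 < e" "1 < s"
  shows "u powr s * x powr (1 - s) \<le> e"
proof -
  have "u powr s \<le> (e powr (1 / s) * x powr ((s - 1) / s)) powr s"
    using assms by (intro powr_mono2) auto
  also have "\<dots> = e * x powr (s - 1)"
    using assms by (simp add: powr_mult powr_powr)
  finally have "u powr s * x powr (1 - s) \<le> e * x powr (s - 1) * x powr (1 - s)"
    by (intro mult_right_mono) auto
  also have "\<dots> = e" using assms by (simp add: powr_add[symmetric])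
  finally show ?thesis .
qed

text \<open>The deterministic core, applied once to the distribution functions and once to their
  reflections, which represent the endpoint 1. The tail bound is assumed for the sequence only,
  because it passes to the limit \<open>G\<close>.\<close>

context
  fixes s :: real and H :: "nat \<Rightarrow> real \<Rightarrow> real" and G :: "real \<Rightarrow> real"
  assumes s: "1 < s"
    and H: "\<And>n x. 0 < x \<Longrightarrow> x < 1 \<Longrightarrow> 0 \<le> H n x \<and> H n x \<le> 1"
    and G: "\<And>x. 0 < x \<Longrightarrow> x < 1 \<Longrightarrow> 0 \<le> G x \<and> G x \<le> 1"
    and unif: "\<And>e. 0 < e \<Longrightarrow> \<forall>\<^sub>F n in sequentially. \<forall>x\<in>{0<..<1}. \<bar>H n x - G x\<bar> \<le> e"
    and tail: "\<And>e. 0 < e \<Longrightarrow> \<exists>d>0. \<forall>\<^sub>F n in sequentially.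
      \<forall>x. 0 < x \<and> x < d \<longrightarrow> H n x \<le> e * x powr ((s - 1) / s)"
begin

lemma powr_quotient_near_zero:
  assumes e: "0 < e"
  obtains d where "0 < d"
    "\<forall>\<^sub>F n in sequentially. \<forall>x. 0 < x \<and> x < d \<and> x < 1 \<longrightarrow> H n x powr s * x powr (1 - s) \<le> e"
    "\<And>x. 0 < x \<Longrightarrow> x < d \<Longrightarrow> x < 1 \<Longrightarrow> G x powr s * x powr (1 - s) \<le> e"
proof -
  have "0 < e powr (1 / s)" using e by simp
  then obtain d where d: "0 < d" and ev: "\<forall>\<^sub>F n in sequentially.
      \<forall>x. 0 < x \<and> x < d \<longrightarrow> H n x \<le> e powr (1 / s) * x powr ((s - 1) / s)"
    using tail by blast
  show ?thesis
  proof
    show "\<forall>\<^sub>F n in sequentially. \<forall>x. 0 < x \<and> x < d \<and> x < 1 \<longrightarrow> H n x powr s * x powr (1 - s) \<le> e"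
      using ev by eventually_elim (use H e s in \<open>auto intro!: powr_quotient_le\<close>)
    fix x assume x: "0 < x" "x < d" "x < 1"
    \<comment> \<open>A single \<open>n\<close> satisfying both the tail bound and closeness within
      an arbitrary \<open>\<eta>\<close> transfers the bound to \<open>G\<close>.\<close>
    have "G x \<le> e powr (1 / s) * x powr ((s - 1) / s)"
    proof (rule field_le_epsilon)
      fix \<eta> :: real assume "0 < \<eta>"
      from eventually_conj[OF ev unif[OF this]]
      obtain n where "\<forall>x. 0 < x \<and> x < d \<longrightarrow> H n x \<le> e powr (1 / s) * x powr ((s - 1) / s)"
        "\<forall>x\<in>{0<..<1}. \<bar>H n x - G x\<bar> \<le> \<eta>"
        by (auto simp: eventually_sequentially)
      then have "H n x \<le> e powr (1 / s) * x powr ((s - 1) / s)" "\<bar>H n x - G x\<bar> \<le> \<eta>"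
        using x by auto
      then show "G x \<le> e powr (1 / s) * x powr ((s - 1) / s) + \<eta>" by linarith
    qed
    then show "G x powr s * x powr (1 - s) \<le> e"
      using G[of x] x e s by (intro powr_quotient_le) auto
  qed fact
qed

text \<open>Below \<open>d\<close> both weighted powers lie between 0 and \<open>e\<close>, so their
  difference is at most \<open>e\<close>. Above \<open>d\<close> the weight is bounded and the power
  is Lipschitz, so uniform convergence suffices.\<close>

lemma powr_quotient_uniform:
  assumes e: "0 < e"
  shows "\<forall>\<^sub>F n in sequentially. \<forall>x\<in>{0<..<1}.
    \<bar>H n x powr s * x powr (1 - s) - G x powr s * x powr (1 - s)\<bar> \<le> e"
proof -
  obtain d where d: "0 < d"
    and Hd: "\<forall>\<^sub>F n in sequentially. \<forall>x. 0 < x \<and> x < d \<and> x < 1 \<longrightarrow> H n x powr s * x powr (1 - s) \<le> e"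
    and Gd: "\<And>x. 0 < x \<Longrightarrow> x < d \<Longrightarrow> x < 1 \<Longrightarrow> G x powr s * x powr (1 - s) \<le> e"
    using powr_quotient_near_zero[OF e] by blast
  \<comment> \<open>Chosen so that the Lipschitz constant \<open>s\<close> times the largest weight
    \<open>d powr (1 - s)\<close> turns \<open>\<eta>\<close> into \<open>e\<close>.\<close>
  define \<eta> where "\<eta> = e / (s * d powr (1 - s))"
  have eta: "0 < \<eta>" using e d s by (simp add: \<eta>_def)
  from Hd unif[OF eta] show ?thesis
  proof eventually_elim
    case (elim n)
    show ?case
    proof
      fix x :: real assume "x \<in> {0<..<1}"
      then have x: "0 < x" "x < 1" by auto
      show "\<bar>H n x powr s * x powr (1 - s) - G x powr s * x powr (1 - s)\<bar> \<le> e"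
      proof (cases "x < d")
        case True
        have "0 \<le> H n x powr s * x powr (1 - s)" "0 \<le> G x powr s * x powr (1 - s)" by auto
        moreover have "H n x powr s * x powr (1 - s) \<le> e" "G x powr s * x powr (1 - s) \<le> e"
          using elim(1) Gd x True by auto
        ultimately show ?thesis by linarith
      next
        case False
        have "\<bar>H n x powr s * x powr (1 - s) - G x powr s * x powr (1 - s)\<bar>
            = \<bar>H n x powr s - G x powr s\<bar> * x powr (1 - s)"
          by (simp add: left_diff_distrib[symmetric] abs_mult)
        also have "\<dots> \<le> (s * \<bar>H n x - G x\<bar>) * d powr (1 - s)"
          using H[OF x, of n] G[OF x] s d False by (intro mult_mono powr_diff_le powr_mono2') auto
        also have "\<dots> \<le> (s * \<eta>) * d powr (1 - s)"
          using elim(2) x s by (intro mult_right_mono mult_left_mono) auto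
        also have "\<dots> = e" using s d by (simp add: \<eta>_def)
        finally show ?thesis .
      qed
    qed
  qed
qed

lemma powr_quotient_bounded: "\<exists>C. \<forall>x\<in>{0<..<1}. G x powr s * x powr (1 - s) \<le> C"
proof -
  obtain d where d: "0 < d"
    and Gd: "\<And>x. 0 < x \<Longrightarrow> x < d \<Longrightarrow> x < 1 \<Longrightarrow> G x powr s * x powr (1 - s) \<le> 1"
    using powr_quotient_near_zero[of 1] by auto
  have "G x powr s * x powr (1 - s) \<le> max 1 (d powr (1 - s))" if x: "0 < x" "x < 1" for x
  proof (cases "x < d")
    case True
    with Gd x show ?thesis by (simp add: le_max_iff_disj)
  next
    case False
    have "G x powr s * x powr (1 - s) \<le> 1 * d powr (1 - s)"
      using G[OF x] False d s by (intro mult_mono powr_le1 powr_mono2') auto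
    then show ?thesis by simp
  qed
  then show ?thesis by (intro exI[of _ "max 1 (d powr (1 - s))"]) auto
qed

end

text \<open>Functions within \<open>e\<close> of each other have suprema within \<open>e\<close>.
  The upper bound on \<open>g\<close> makes the limiting supremum a real number, so that
  \<open>e\<close> can be subtracted from it.\<close>

lemma SUP_ereal_uniform_tendsto:
  fixes f :: "nat \<Rightarrow> 'b \<Rightarrow> real"
  assumes ne: "A \<noteq> {}" and bd: "\<And>x. x \<in> A \<Longrightarrow> g x \<le> C"
    and unif: "\<And>e. 0 < e \<Longrightarrow> \<forall>\<^sub>F n in sequentially. \<forall>x\<in>A. \<bar>f n x - g x\<bar> \<le> e"
  shows "(SUP x\<in>A. ereal (g x)) < \<infinity>"
    and "(\<lambda>n. SUP x\<in>A. ereal (f n x)) \<longlonglongrightarrow> (SUP x\<in>A. ereal (g x))"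
proof -
  let ?L = "SUP x\<in>A. ereal (g x)"
  have "?L \<le> ereal C" using bd by (intro SUP_least) auto
  then show fin: "?L < \<infinity>" by (rule le_less_trans) simp
  obtain a where a: "a \<in> A" using ne by auto
  then have "ereal (g a) \<le> ?L" by (rule SUP_upper)
  with fin obtain l where l: "?L = ereal l" by (cases ?L) auto
  have close: "\<forall>\<^sub>F n in sequentially.
      ereal (l - e) \<le> (SUP x\<in>A. ereal (f n x)) \<and> (SUP x\<in>A. ereal (f n x)) \<le> ereal (l + e)"
    if "0 < e" for e
    using unif[OF that]
  proof eventually_elim
    case (elim n)
    have "(SUP x\<in>A. ereal (f n x)) \<le> ereal (l + e)"
    proof (rule SUP_least)
      fix x assume x: "x \<in> A"
      have "ereal (g x) \<le> ?L" using x by (rule SUP_upper)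
      then have "g x \<le> l" unfolding l by simp
      with elim x show "ereal (f n x) \<le> ereal (l + e)" by (auto dest!: bspec)
    qed
    moreover have "?L \<le> (SUP x\<in>A. ereal (f n x)) + ereal e"
    proof (rule SUP_least)
      fix x assume x: "x \<in> A"
      have "g x \<le> f n x + e" using elim x by (auto dest!: bspec)
      then have "ereal (g x) \<le> ereal (f n x) + ereal e" by simp
      also have "\<dots> \<le> (SUP x\<in>A. ereal (f n x)) + ereal e"
        by (intro add_right_mono SUP_upper x)
      finally show "ereal (g x) \<le> (SUP x\<in>A. ereal (f n x)) + ereal e" .
    qed
    then have "ereal (l - e) \<le> (SUP x\<in>A. ereal (f n x))"
      unfolding l by (cases "SUP x\<in>A. ereal (f n x)") auto
    ultimately show ?case by simp
  qed
  show "(\<lambda>n. SUP x\<in>A. ereal (f n x)) \<longlonglongrightarrow> ?L"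
    unfolding l
  proof (rule order_tendstoI)
    fix b assume "b < ereal l"
    then obtain z where z: "b < ereal z" "z < l" using ereal_dense2 by force
    show "\<forall>\<^sub>F n in sequentially. b < (SUP x\<in>A. ereal (f n x))"
      using close[of "l - z"] z by (auto elim!: eventually_mono intro: less_le_trans)
  next
    fix b assume "ereal l < b"
    then obtain z where z: "ereal z < b" "l < z" using ereal_dense2 by force
    show "\<forall>\<^sub>F n in sequentially. (SUP x\<in>A. ereal (f n x)) < b"
      using close[of "z - l"] z by (auto elim!: eventually_mono intro: le_less_trans)
  qed
qed

section \<open>The supremum of the divergence\<close>

lemma emp_cdf_bounds: "0 \<le> emp_cdf W n \<omega> x" "emp_cdf W n \<omega> x \<le> 1"
proof -
  show "0 \<le> emp_cdf W n \<omega> x" unfolding emp_cdf_def by (intro mult_nonneg_nonneg sum_nonneg) auto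
  have "(\<Sum>i=1..n. indicator {..x} (W i \<omega>)) \<le> (\<Sum>i=1..n. 1 :: real)"
    by (intro sum_mono) (auto simp: indicator_def)
  then show "emp_cdf W n \<omega> x \<le> 1" by (cases "n = 0") (auto simp: emp_cdf_def)
qed

lemma one_minus_emp_cdf:
  assumes "0 < n"
  shows "1 - emp_cdf W n \<omega> x = (1 / real n) * (\<Sum>i=1..n. indicator {x<..} (W i \<omega>))"
proof -
  have "(\<Sum>i=1..n. indicator {x<..} (W i \<omega>)) = (\<Sum>i=1..n. 1 - indicator {..x} (W i \<omega>) :: real)"
    by (rule sum.cong) (auto simp: indicator_def)
  then show ?thesis using assms by (simp add: emp_cdf_def sum_subtractf field_simps)
qed

lemma sum_indicator_ge_1:
  fixes n :: nat
  assumes "w n \<in> B" "1 \<le> n"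
  shows "(1::real) \<le> (\<Sum>i=1..n. indicator B (w i))"
proof -
  have "(1::real) = (\<Sum>i\<in>{n}. indicator B (w i))" using assms by simp
  also have "\<dots> \<le> (\<Sum>i=1..n. indicator B (w i))" using assms by (intro sum_mono2) auto
  finally show ?thesis .
qed

text \<open>The point \<open>x\<close> is chosen so that \<open>x powr (1 - s)\<close> equals
  \<open>(c * n) powr s\<close>: mass \<open>1/n\<close> beyond it contributes at least
  \<open>c powr s\<close>, and the other summand is nonnegative. The two alternatives for
  \<open>v\<close> treat the two endpoints; \<open>2 \<le> c\<close> keeps \<open>x\<close> below
  1.\<close>

lemma sup_K_div_ge:
  assumes s: "1 < s" and n: "1 \<le> n" and c: "2 \<le> c"
    and x: "x = (1 / (c * real n)) powr (s / (s - 1))"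
    and G: "v = x \<and> 1 / real n \<le> G v \<or> v = 1 - x \<and> 1 / real n \<le> 1 - G v"
  shows "ereal ((c powr s - 1) / (s * (s - 1))) \<le> sup_K_div s G"
proof -
  let ?y = "1 / (c * real n)"
  have "1 < c * real n" using n c mult_mono[of 2 c 1 "real n"] by simp
  then have y: "0 < ?y" "?y < 1" by auto
  have x01: "0 < x" "x < 1"
    unfolding x using n y s powr_less_mono2[of "s / (s - 1)" ?y 1] by auto
  have "x powr (1 - s) = ?y powr (s / (s - 1) * (1 - s))" by (simp add: x powr_powr)
  also have "s / (s - 1) * (1 - s) = - s" using s by (simp add: field_simps)
  also have "?y powr (- s) = c powr s * real n powr s"
    using c n by (simp add: powr_minus powr_divide powr_mult)
  finally have xs: "x powr (1 - s) = c powr s * real n powr s" .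
  have large: "c powr s \<le> u powr s * x powr (1 - s)" if u: "1 / real n \<le> u" for u
  proof -
    have "c powr s = (1 / real n) powr s * x powr (1 - s)"
      unfolding xs using n by (simp add: powr_divide)
    also have "\<dots> \<le> u powr s * x powr (1 - s)"
      using u s by (intro mult_right_mono powr_mono2) auto
    finally show ?thesis .
  qed
  have "c powr s \<le> G v powr s * v powr (1 - s) + (1 - G v) powr s * (1 - v) powr (1 - s)"
    using G
  proof (elim disjE conjE)
    assume "v = x" "1 / real n \<le> G v"
    then show ?thesis using large[of "G v"] by (simp add: add_increasing2)
  next
    assume "v = 1 - x" "1 / real n \<le> 1 - G v"
    then show ?thesis using large[of "1 - G v"] by (simp add: add_increasing)
  qed
  then have "(c powr s - 1) / (s * (s - 1)) \<le> K_div s (G v) v"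
    unfolding K_div_def using s by (simp add: divide_right_mono)
  moreover have "ereal (K_div s (G v) v) \<le> sup_K_div s G"
    unfolding sup_K_div_def using G x01 by (intro SUP_upper) auto
  ultimately show ?thesis by (meson ereal_less_eq(3) order.trans)
qed

section \<open>Almost sure convergence and almost sure large values of the supremum\<close>

context iid_reals
begin

text \<open>The \<open>ennreal\<close> inverse is infinite at 0, whereas the real power is 0 there.
  Finiteness of the integral excludes the value 0 almost surely, and elsewhere the two expressions
  agree.\<close>

lemma integrable_powr_minus:
  assumes nonneg: "AE \<omega> in M. 0 \<le> W 1 \<omega>"
    and fin: "(\<integral>\<^sup>+\<omega>. inverse (ennreal (W 1 \<omega> powr p)) \<partial>M) < \<infinity>"
  shows "AE \<omega> in M. 0 < W 1 \<omega>" "integrable M (\<lambda>\<omega>. W 1 \<omega> powr (- p))"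
proof -
  have "AE \<omega> in M. inverse (ennreal (W 1 \<omega> powr p)) \<noteq> \<infinity>"
    by (rule nn_integral_PInf_AE) (use fin in \<open>auto simp: less_top\<close>)
  then show pos: "AE \<omega> in M. 0 < W 1 \<omega>"
    using nonneg
  proof eventually_elim
    case (elim \<omega>)
    then have "W 1 \<omega> \<noteq> 0" by auto
    with elim show ?case by simp
  qed
  show "integrable M (\<lambda>\<omega>. W 1 \<omega> powr (- p))"
  proof (rule integrableI_nonneg)
    have "(\<integral>\<^sup>+\<omega>. ennreal (W 1 \<omega> powr (- p)) \<partial>M) = (\<integral>\<^sup>+\<omega>. inverse (ennreal (W 1 \<omega> powr p)) \<partial>M)"
      by (rule nn_integral_cong_AE, use pos in eventually_elim)
        (simp add: inverse_ennreal powr_minus)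
    with fin show "(\<integral>\<^sup>+\<omega>. ennreal (W 1 \<omega> powr (- p)) \<partial>M) < \<infinity>" by simp
  qed auto
qed

lemma sup_K_div_tendsto:
  assumes s: "1 < s" and unit: "AE \<omega> in M. 0 \<le> W 1 \<omega> \<and> W 1 \<omega> \<le> 1"
    and fin0: "(\<integral>\<^sup>+\<omega>. inverse (ennreal (W 1 \<omega> powr ((s - 1) / s))) \<partial>M) < \<infinity>"
    and fin1: "(\<integral>\<^sup>+\<omega>. inverse (ennreal ((1 - W 1 \<omega>) powr ((s - 1) / s))) \<partial>M) < \<infinity>"
  shows "AE \<omega> in M. sup_K_div s (cdf (distr M borel (W 1))) < \<infinity> \<and>
    (\<lambda>n. sup_K_div s (emp_cdf W n \<omega>)) \<longlonglongrightarrow> sup_K_div s (cdf (distr M borel (W 1)))"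
proof -
  interpret V: iid_reals M "\<lambda>i \<omega>. 1 - W i \<omega>" by (rule compose) simp
  interpret D: real_distribution "distr M borel (W 1)" by simp
  let ?F = "cdf (distr M borel (W 1))"
  let ?p = "(s - 1) / s"
  have p: "0 < ?p" using s by simp
  have "AE \<omega> in M. 0 \<le> W 1 \<omega>" "AE \<omega> in M. 0 \<le> 1 - W 1 \<omega>" using unit by auto
  then have "AE \<omega> in M. \<forall>e>0. \<exists>d>0. \<forall>\<^sub>F n in sequentially. \<forall>x. 0 < x \<and> x < d \<longrightarrow>
        emp_cdf W n \<omega> x \<le> e * x powr ?p"
    "AE \<omega> in M. \<forall>e>0. \<exists>d>0. \<forall>\<^sub>F n in sequentially. \<forall>x. 0 < x \<and> x < d \<longrightarrow>
        emp_cdf (\<lambda>i \<omega>. 1 - W i \<omega>) n \<omega> x \<le> e * x powr ?p"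
    using AE_emp_cdf_le_powr[OF p integrable_powr_minus] V.AE_emp_cdf_le_powr[OF p V.integrable_powr_minus]
      fin0 fin1 by blast+
  with Glivenko_Cantelli show ?thesis
  proof eventually_elim
    case (elim \<omega>)
    \<comment> \<open>The second summand of \<open>K_div\<close> at \<open>x\<close> is the first
      summand formed with these reflected functions at \<open>1 - x\<close>.\<close>
    let ?H = "\<lambda>n x. 1 - emp_cdf W n \<omega> (1 - x)" and ?G = "\<lambda>x. 1 - ?F (1 - x)"
    have F01: "0 \<le> ?F x" "?F x \<le> 1" for x
      using D.cdf_nonneg D.cdf_bounded_prob by auto
    have unif: "\<forall>\<^sub>F n in sequentially. \<forall>x\<in>{0<..<1}. \<bar>emp_cdf W n \<omega> x - ?F x\<bar> \<le> e" if "0 < e" for e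
      using elim(1)[rule_format, OF that] by eventually_elim auto
    have unif': "\<forall>\<^sub>F n in sequentially. \<forall>x\<in>{0<..<1}. \<bar>?H n x - ?G x\<bar> \<le> e" if "0 < e" for e
      using elim(1)[rule_format, OF that]
    proof eventually_elim
      case (elim n)
      show ?case
      proof
        fix x
        show "\<bar>?H n x - ?G x\<bar> \<le> e" using elim[rule_format, of "1 - x"] by linarith
      qed
    qed
    \<comment> \<open>The left side counts \<open>1 - W i < x\<close> strictly and the right side
      also counts equality. At \<open>n = 0\<close> the empirical distribution function is 0, its
      reflection is 1, and the inequality fails.\<close>
    have H_le: "?H n x \<le> emp_cdf (\<lambda>i \<omega>. 1 - W i \<omega>) n \<omega> x" if "0 < n" for n x
      unfolding one_minus_emp_cdf[OF that] emp_cdf_def[of "\<lambda>i \<omega>. 1 - W i \<omega>"]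
      by (intro mult_left_mono sum_mono) (auto simp: indicator_def)
    have tail': "\<exists>d>0. \<forall>\<^sub>F n in sequentially. \<forall>x. 0 < x \<and> x < d \<longrightarrow> ?H n x \<le> e * x powr ?p"
      if e: "0 < e" for e
    proof -
      obtain d where d: "0 < d" "\<forall>\<^sub>F n in sequentially. \<forall>x. 0 < x \<and> x < d \<longrightarrow>
          emp_cdf (\<lambda>i \<omega>. 1 - W i \<omega>) n \<omega> x \<le> e * x powr ?p"
        using elim(3) e by blast
      have "\<forall>\<^sub>F n in sequentially. \<forall>x. 0 < x \<and> x < d \<longrightarrow> ?H n x \<le> e * x powr ?p"
        using d(2) eventually_gt_at_top[of 0]
      proof eventually_elim
        case (elim n)
        then show ?case using H_le[OF elim(2)] order.trans by blast
      qed
      with d(1) show ?thesis by blast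
    qed
    note left = powr_quotient_uniform[of s "\<lambda>n. emp_cdf W n \<omega>" ?F]
      powr_quotient_bounded[of s "\<lambda>n. emp_cdf W n \<omega>" ?F]
    note right = powr_quotient_uniform[of s ?H ?G] powr_quotient_bounded[of s ?H ?G]
    have L: "\<forall>\<^sub>F n in sequentially. \<forall>x\<in>{0<..<1}.
        \<bar>emp_cdf W n \<omega> x powr s * x powr (1 - s) - ?F x powr s * x powr (1 - s)\<bar> \<le> e" if "0 < e" for e
      by (rule left(1)) (use s emp_cdf_bounds F01 unif elim(2) that in auto)
    have R: "\<forall>\<^sub>F n in sequentially. \<forall>x\<in>{0<..<1}.
        \<bar>?H n x powr s * x powr (1 - s) - ?G x powr s * x powr (1 - s)\<bar> \<le> e" if "0 < e" for e
      by (rule right(1)) (use s emp_cdf_bounds F01 unif' tail' that in auto)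
    have "\<exists>C. \<forall>x\<in>{0<..<1}. ?F x powr s * x powr (1 - s) \<le> C"
      by (rule left(2)) (use s emp_cdf_bounds F01 unif elim(2) in auto)
    moreover have "\<exists>C. \<forall>x\<in>{0<..<1}. ?G x powr s * x powr (1 - s) \<le> C"
      by (rule right(2)) (use s emp_cdf_bounds F01 unif' tail' in auto)
    ultimately obtain C1 C2 where C: "\<And>x. x \<in> {0<..<1} \<Longrightarrow> ?F x powr s * x powr (1 - s) \<le> C1"
      "\<And>x. x \<in> {0<..<1} \<Longrightarrow> ?G x powr s * x powr (1 - s) \<le> C2" by blast
    have K: "K_div s (?F x) x \<le> 1 / (s * (s - 1)) * (C1 + C2 - 1)" if "x \<in> {0<..<1}" for x
      unfolding K_div_def using C(1)[of x] C(2)[of "1 - x"] that s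
      by (intro mult_left_mono) auto
    have Kunif: "\<forall>\<^sub>F n in sequentially. \<forall>x\<in>{0<..<1}. \<bar>K_div s (emp_cdf W n \<omega> x) x - K_div s (?F x) x\<bar> \<le> e"
      if e: "0 < e" for e
    proof -
      let ?k = "s * (s - 1)"
      have k: "0 < ?k" using s by simp
      \<comment> \<open>Two summands, each within \<open>\<eta>\<close>, are divided by
        \<open>s * (s - 1)\<close>.\<close>
      define \<eta> where "\<eta> = e * ?k / 2"
      have eta: "0 < \<eta>" using e k by (simp add: \<eta>_def)
      from L[OF eta] R[OF eta] show ?thesis
      proof eventually_elim
        case (elim n)
        show ?case
        proof
          fix x :: real assume x: "x \<in> {0<..<1}"
          have "\<bar>emp_cdf W n \<omega> x powr s * x powr (1 - s) - ?F x powr s * x powr (1 - s)\<bar> \<le> \<eta>"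
            using elim(1) x by blast
          moreover have "\<bar>(1 - emp_cdf W n \<omega> x) powr s * (1 - x) powr (1 - s)
              - (1 - ?F x) powr s * (1 - x) powr (1 - s)\<bar> \<le> \<eta>"
            using bspec[OF elim(2), of "1 - x"] x by simp
          ultimately have "\<bar>emp_cdf W n \<omega> x powr s * x powr (1 - s)
                + (1 - emp_cdf W n \<omega> x) powr s * (1 - x) powr (1 - s) - 1
              - (?F x powr s * x powr (1 - s) + (1 - ?F x) powr s * (1 - x) powr (1 - s) - 1)\<bar> \<le> 2 * \<eta>"
            by linarith
          then have "1 / ?k * \<bar>emp_cdf W n \<omega> x powr s * x powr (1 - s)
                + (1 - emp_cdf W n \<omega> x) powr s * (1 - x) powr (1 - s) - 1
              - (?F x powr s * x powr (1 - s) + (1 - ?F x) powr s * (1 - x) powr (1 - s) - 1)\<bar>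
              \<le> 1 / ?k * (2 * \<eta>)"
            using k by (intro mult_left_mono) auto
          also have "1 / ?k * (2 * \<eta>) = e" using s by (simp add: \<eta>_def)
          finally show "\<bar>K_div s (emp_cdf W n \<omega> x) x - K_div s (?F x) x\<bar> \<le> e"
            unfolding K_div_def right_diff_distrib[symmetric] abs_mult using k by simp
        qed
      qed
    qed
    have "{0<..<1::real} \<noteq> {}" by simp
    from SUP_ereal_uniform_tendsto[OF this K Kunif] show ?case
      unfolding sup_K_div_def by blast
  qed
qed

lemma sup_K_div_frequently_large:
  assumes s: "1 < s" and c: "2 \<le> c" and unit: "AE \<omega> in M. 0 \<le> W 1 \<omega> \<and> W 1 \<omega> \<le> 1"
    and inf: "(\<integral>\<^sup>+\<omega>. inverse (ennreal (W 1 \<omega> powr ((s - 1) / s))) \<partial>M) = \<infinity> \<or>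
      (\<integral>\<^sup>+\<omega>. inverse (ennreal ((1 - W 1 \<omega>) powr ((s - 1) / s))) \<partial>M) = \<infinity>"
  shows "AE \<omega> in M. \<exists>\<^sub>F n in sequentially. ereal ((c powr s - 1) / (s * (s - 1))) \<le> sup_K_div s (emp_cdf W n \<omega>)"
proof -
  let ?p = "(s - 1) / s" and ?x = "\<lambda>n. (1 / (c * real n)) powr (s / (s - 1))"
  have p: "0 < ?p" "1 / ?p = s / (s - 1)" using s by auto
  show ?thesis
    using inf
  proof
    assume "(\<integral>\<^sup>+\<omega>. inverse (ennreal (W 1 \<omega> powr ?p)) \<partial>M) = \<infinity>"
    then have "AE \<omega> in M. \<exists>\<^sub>F n in sequentially. W n \<omega> < ?x n"
      using AE_infinitely_often_small[of ?p c] p c unit by auto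
    then show ?thesis
    proof eventually_elim
      case (elim \<omega>)
      then have "\<exists>\<^sub>F n in sequentially. W n \<omega> < ?x n \<and> 1 \<le> n"
        by (intro frequently_eventually_frequently eventually_ge_at_top)
      then show ?case
      proof (rule frequently_elim1)
        fix n assume n: "W n \<omega> < ?x n \<and> 1 \<le> n"
        have "1 \<le> (\<Sum>i=1..n. indicator {..?x n} (W i \<omega>) :: real)"
          using n by (intro sum_indicator_ge_1) auto
        then have "1 / real n \<le> emp_cdf W n \<omega> (?x n)"
          unfolding emp_cdf_def using n by (simp add: divide_right_mono)
        then show "ereal ((c powr s - 1) / (s * (s - 1))) \<le> sup_K_div s (emp_cdf W n \<omega>)"
          using s c n by (intro sup_K_div_ge[of s n c "?x n" "?x n"]) auto
      qed
    qed
  next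
    assume inf1: "(\<integral>\<^sup>+\<omega>. inverse (ennreal ((1 - W 1 \<omega>) powr ?p)) \<partial>M) = \<infinity>"
    interpret V: iid_reals M "\<lambda>i \<omega>. 1 - W i \<omega>" by (rule compose) simp
    have "AE \<omega> in M. 0 \<le> 1 - W 1 \<omega>" using unit by auto
    then have "AE \<omega> in M. \<exists>\<^sub>F n in sequentially. 1 - W n \<omega> < ?x n"
      using V.AE_infinitely_often_small[of ?p c] p c inf1 by auto
    then show ?thesis
    proof eventually_elim
      case (elim \<omega>)
      then have "\<exists>\<^sub>F n in sequentially. 1 - W n \<omega> < ?x n \<and> 1 \<le> n"
        by (intro frequently_eventually_frequently eventually_ge_at_top)
      then show ?case
      proof (rule frequently_elim1)
        fix n assume n: "1 - W n \<omega> < ?x n \<and> 1 \<le> n"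
        \<comment> \<open>The empirical distribution function includes its argument, so the strict
          inequality for \<open>W n\<close> is what places it in the complementary count.\<close>
        have "1 \<le> (\<Sum>i=1..n. indicator {1 - ?x n<..} (W i \<omega>) :: real)"
          using n by (intro sum_indicator_ge_1) auto
        moreover have pos: "0 < n" using n by simp
        ultimately have G: "1 / real n \<le> 1 - emp_cdf W n \<omega> (1 - ?x n)"
          unfolding one_minus_emp_cdf[OF pos] using n by (simp add: divide_right_mono)
        show "ereal ((c powr s - 1) / (s * (s - 1))) \<le> sup_K_div s (emp_cdf W n \<omega>)"
          using s c n G by (intro sup_K_div_ge[of s n c "?x n" "1 - ?x n"]) auto
      qed
    qed
  qed
qed

end

section \<open>The integrability condition\<close>

text \<open>Quantile transform: the pseudoinverse \<open>I\<close> is the same infimum as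
  \<open>quantile\<close>, and it carries the uniform law on the open unit interval to
  \<open>M\<close>.\<close>

lemma (in cdf_distribution) nn_integral_quantile:
  assumes [measurable]: "\<phi> \<in> borel_measurable borel"
  shows "(\<integral>\<^sup>+u\<in>{0<..<1}. \<phi> (quantile (cdf M) u) \<partial>lborel) = (\<integral>\<^sup>+x. \<phi> x \<partial>M)"
proof -
  have "(\<integral>\<^sup>+x. \<phi> x \<partial>M) = (\<integral>\<^sup>+x. \<phi> x \<partial>distr (restrict_space lborel {0<..<1}) borel I)"
    by (simp add: distr_I_eq_M)
  also have "\<dots> = (\<integral>\<^sup>+u. \<phi> (I u) \<partial>restrict_space lborel {0<..<1})"
    by (rule nn_integral_distr) (auto simp: measurable_CI cong: measurable_cong_sets)
  also have "\<dots> = (\<integral>\<^sup>+u\<in>{0<..<1}. \<phi> (I u) \<partial>lborel)"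
    by (subst nn_integral_restrict_space) auto
  finally show ?thesis by (simp add: quantile_def)
qed

text \<open>One of the two factors is at least 1/2, so the product is at least half of the other
  one; the power costs \<open>2 powr p\<close>.\<close>

lemma inverse_powr_product_le:
  fixes x p :: real
  assumes x: "0 \<le> x" "x \<le> 1" and p: "0 < p"
  shows "inverse (ennreal ((x * (1 - x)) powr p))
    \<le> ennreal (2 powr p) * (inverse (ennreal (x powr p)) + inverse (ennreal ((1 - x) powr p)))"
proof -
  have half: "inverse (ennreal ((x * (1 - x)) powr p)) \<le> ennreal (2 powr p) * inverse (ennreal (y powr p))"
    if y: "0 \<le> y" "y / 2 \<le> x * (1 - x)" for y
  proof (cases "y = 0")
    case False
    have "y powr p / 2 powr p = (y / 2) powr p" using y by (simp add: powr_divide)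
    also have "\<dots> \<le> (x * (1 - x)) powr p" using y p by (intro powr_mono2) auto
    finally have "inverse ((x * (1 - x)) powr p) \<le> inverse (y powr p / 2 powr p)"
      using y False by (intro le_imp_inverse_le) auto
    then have "inverse ((x * (1 - x)) powr p) \<le> 2 powr p * inverse (y powr p)"
      by (simp add: divide_inverse mult.commute)
    then have "ennreal (inverse ((x * (1 - x)) powr p)) \<le> ennreal (2 powr p) * ennreal (inverse (y powr p))"
      by (simp add: ennreal_leI flip: ennreal_mult')
    moreover have "0 < x * (1 - x)" using y False by linarith
    then have "0 < (x * (1 - x)) powr p" unfolding powr_gt_zero by (rule less_imp_neq[THEN not_sym])
    moreover have "0 < y powr p" using False by simp
    ultimately show ?thesis by (simp only: inverse_ennreal)
  qed (simp add: ennreal_mult_top)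
  consider "x \<le> 1 / 2" | "1 - x \<le> 1 / 2" by linarith
  then show ?thesis
  proof cases
    case 1
    have "x * (1 / 2) \<le> x * (1 - x)" using 1 x by (intro mult_left_mono) auto
    then show ?thesis using half[of x] x by (auto simp: distrib_left add_increasing2)
  next
    case 2
    have "(1 / 2) * (1 - x) \<le> x * (1 - x)" using 2 x by (intro mult_right_mono) auto
    then show ?thesis using half[of "1 - x"] x by (auto simp: distrib_left add_increasing)
  qed
qed

text \<open>This separates the two endpoints. The product is at most each of its factors, which
  gives one direction; the other integrates the preceding pointwise bound.\<close>

lemma nn_integral_inverse_product_finite_iff:
  fixes W :: "'a \<Rightarrow> real"
  assumes [measurable]: "W \<in> borel_measurable M" and p: "0 < p"
    and unit: "AE \<omega> in M. 0 \<le> W \<omega> \<and> W \<omega> \<le> 1"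
  shows "(\<integral>\<^sup>+\<omega>. inverse (ennreal ((W \<omega> * (1 - W \<omega>)) powr p)) \<partial>M) < \<infinity> \<longleftrightarrow>
    (\<integral>\<^sup>+\<omega>. inverse (ennreal (W \<omega> powr p)) \<partial>M) < \<infinity> \<and>
    (\<integral>\<^sup>+\<omega>. inverse (ennreal ((1 - W \<omega>) powr p)) \<partial>M) < \<infinity>"
    (is "?A < _ \<longleftrightarrow> ?B < _ \<and> ?C < _")
proof
  have mono: "inverse (ennreal (b powr p)) \<le> inverse (ennreal (a powr p))"
    if "0 \<le> a" "a \<le> b" for a b :: real
  proof (cases "a = 0")
    case False
    then have "inverse (b powr p) \<le> inverse (a powr p)"
      using that p by (intro le_imp_inverse_le powr_mono2) auto
    then show ?thesis using that False by (simp add: inverse_ennreal ennreal_leI)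
  qed simp
  have "?B \<le> ?A" "?C \<le> ?A"
    by (rule nn_integral_mono_AE, use unit in eventually_elim,
        rule mono, auto intro: mult_left_le mult_left_le_one_le)+
  then show "?B < \<infinity> \<and> ?C < \<infinity>" if "?A < \<infinity>"
    using that by (auto intro: le_less_trans)
next
  assume fin: "?B < \<infinity> \<and> ?C < \<infinity>"
  have "?A \<le> (\<integral>\<^sup>+\<omega>. ennreal (2 powr p) * (inverse (ennreal (W \<omega> powr p))
      + inverse (ennreal ((1 - W \<omega>) powr p))) \<partial>M)"
    by (rule nn_integral_mono_AE, use unit in eventually_elim)
      (use inverse_powr_product_le p in auto)
  also have "\<dots> = ennreal (2 powr p) * (?B + ?C)"
    by (simp add: nn_integral_cmult nn_integral_add)
  also have "\<dots> < \<infinity>"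
    using fin by (simp add: ennreal_mult_less_top)
  finally show "?A < \<infinity>" .
qed

text \<open>The mass of the negative half-line is the left limit of the distribution function at 0,
  so an atom at 0 remains possible.\<close>

lemma (in real_distribution) AE_unit_interval:
  assumes F: "cdf_on_unit (cdf M)"
  shows "AE x in M. 0 \<le> x \<and> x \<le> 1"
proof -
  have "(cdf M \<longlongrightarrow> 0) (at_left 0)"
    by (rule tendsto_eventually) (use F in \<open>auto simp: cdf_on_unit_def eventually_at_filter\<close>)
  from tendsto_unique[OF _ this cdf_at_left[of 0]] have "prob {..<0} = 0" by simp
  then have "AE x in M. x \<notin> {..<0}" by (subst (asm) prob_eq_0) auto
  moreover have "prob {..1} = 1" using F by (simp add: cdf_on_unit_def cdf_def)
  then have "AE x in M. x \<in> {..1}" by (subst (asm) prob_eq_1) auto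
  ultimately show ?thesis by eventually_elim auto
qed

section \<open>Equivalence of convergence, the quantile integral and the moment condition\<close>

theorem proposition4p2:
  fixes F :: "real \<Rightarrow> real" and s :: real
    and M :: "'a measure" and X :: "nat \<Rightarrow> 'a \<Rightarrow> real"
  assumes "cdf_on_unit F"
    and "prob_space M"
    and "prob_space.indep_vars M (\<lambda>_. borel) X {1..}"
    and "\<And>i. i \<ge> 1 \<Longrightarrow> cdf (distr M borel (X i)) = F"
    and "s > 1"
  shows "((sup_K_div s F < \<infinity> \<and>
           (AE \<omega> in M. (\<lambda>n. sup_K_div s (emp_cdf X n \<omega>)) \<longlonglongrightarrow> sup_K_div s F))
          \<longleftrightarrow>
          (\<integral>\<^sup>+u\<in>{0<..<1}. 1 / ennreal ((quantile F u * (1 - quantile F u)) powr ((s - 1) / s)) \<partial>lborel) < \<infinity>)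
       \<and>
         (\<forall>Y \<in> borel_measurable M. cdf (distr M borel Y) = F \<longrightarrow>
           ((\<integral>\<^sup>+u\<in>{0<..<1}. 1 / ennreal ((quantile F u * (1 - quantile F u)) powr ((s - 1) / s)) \<partial>lborel) < \<infinity>
            \<longleftrightarrow>
            (\<integral>\<^sup>+\<omega>. inverse (ennreal ((Y \<omega> * (1 - Y \<omega>)) powr (1 - 1 / s))) \<partial>M) < \<infinity>))"
proof -
  interpret prob_space M by fact
  have rvX: "random_variable borel (X i)" if "1 \<le> i" for i
    using assms(3) that unfolding indep_vars_def by auto
  interpret X: iid_reals M X
  proof
    fix i :: nat assume i: "1 \<le> i"
    show "distr M borel (X i) = distr M borel (X 1)"
      by (rule cdf_unique) (use i rvX assms(4) in auto)
  qed fact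
  let ?p = "(s - 1) / s"
  let ?J = "\<integral>\<^sup>+u\<in>{0<..<1}. 1 / ennreal ((quantile F u * (1 - quantile F u)) powr ?p) \<partial>lborel"
  define \<phi> :: "real \<Rightarrow> ennreal" where "\<phi> x = inverse (ennreal ((x * (1 - x)) powr ?p))" for x
  have [measurable]: "\<phi> \<in> borel_measurable borel" unfolding \<phi>_def by measurable
  have p: "0 < ?p" using assms(5) by simp
  \<comment> \<open>Stated for every \<open>Y\<close> with distribution function \<open>F\<close>:
    \<open>X 1\<close> serves the convergence criterion, and an arbitrary \<open>Y\<close> the
    moment condition.\<close>
  have J: "?J = (\<integral>\<^sup>+\<omega>. \<phi> (Y \<omega>) \<partial>M)"
    if Y: "Y \<in> borel_measurable M" "cdf (distr M borel Y) = F" for Y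
  proof -
    interpret D: cdf_distribution "distr M borel Y"
      unfolding cdf_distribution_def using Y(1) by simp
    have "?J = (\<integral>\<^sup>+u\<in>{0<..<1}. \<phi> (quantile F u) \<partial>lborel)"
      by (simp add: \<phi>_def divide_ennreal_def)
    also have "\<dots> = (\<integral>\<^sup>+x. \<phi> x \<partial>distr M borel Y)"
      using D.nn_integral_quantile[of \<phi>] Y(2) by simp
    also have "\<dots> = (\<integral>\<^sup>+\<omega>. \<phi> (Y \<omega>) \<partial>M)"
      using Y(1) by (intro nn_integral_distr) auto
    finally show ?thesis .
  qed
  have F: "cdf (distr M borel (X 1)) = F" using assms(4) by simp
  interpret D1: real_distribution "distr M borel (X 1)" by simp
  have "AE x in distr M borel (X 1). 0 \<le> x \<and> x \<le> 1"
    by (rule D1.AE_unit_interval) (use F assms(1) in simp)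
  then have unit: "AE \<omega> in M. 0 \<le> X 1 \<omega> \<and> X 1 \<omega> \<le> 1"
    by (subst (asm) AE_distr_iff) auto
  have J_iff: "?J < \<infinity> \<longleftrightarrow> (\<integral>\<^sup>+\<omega>. inverse (ennreal (X 1 \<omega> powr ?p)) \<partial>M) < \<infinity> \<and>
      (\<integral>\<^sup>+\<omega>. inverse (ennreal ((1 - X 1 \<omega>) powr ?p)) \<partial>M) < \<infinity>"
    unfolding J[OF X.rv_1(1) F] \<phi>_def
    by (rule nn_integral_inverse_product_finite_iff[OF X.rv_1(1) p unit])
  have "sup_K_div s F < \<infinity> \<and>
      (AE \<omega> in M. (\<lambda>n. sup_K_div s (emp_cdf X n \<omega>)) \<longlonglongrightarrow> sup_K_div s F)" if fin: "?J < \<infinity>"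
  proof -
    have "AE \<omega> in M. sup_K_div s F < \<infinity> \<and>
        (\<lambda>n. sup_K_div s (emp_cdf X n \<omega>)) \<longlonglongrightarrow> sup_K_div s F"
      using X.sup_K_div_tendsto[OF assms(5) unit] fin unfolding J_iff F by blast
    then show ?thesis by simp
  qed
  moreover have "?J < \<infinity>"
    if fin: "sup_K_div s F < \<infinity>"
      and conv: "AE \<omega> in M. (\<lambda>n. sup_K_div s (emp_cdf X n \<omega>)) \<longlonglongrightarrow> sup_K_div s F"
  proof (rule ccontr)
    assume "\<not> ?J < \<infinity>"
    then have inf: "(\<integral>\<^sup>+\<omega>. inverse (ennreal (X 1 \<omega> powr ?p)) \<partial>M) = \<infinity> \<or>
        (\<integral>\<^sup>+\<omega>. inverse (ennreal ((1 - X 1 \<omega>) powr ?p)) \<partial>M) = \<infinity>"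
      unfolding J_iff by (auto simp: less_top[symmetric])
    obtain l where l: "sup_K_div s F < ereal l" using fin ereal_dense2 by force
    \<comment> \<open>Since \<open>c powr s \<ge> c\<close>, this choice pushes the recurring lower
      bound for the supremum up to \<open>l\<close>, which lies above the supposed finite
      limit.\<close>
    define c where "c = max 2 (s * (s - 1) * l + 1)"
    have c: "2 \<le> c" "s * (s - 1) * l + 1 \<le> c" by (auto simp: c_def)
    have "c powr 1 \<le> c powr s" using c assms(5) by (intro powr_mono) auto
    then have "l \<le> (c powr s - 1) / (s * (s - 1))"
      using c assms(5) by (simp add: field_simps)
    then have lc: "ereal l \<le> ereal ((c powr s - 1) / (s * (s - 1)))" by simp
    have "AE \<omega> in M. False"
      using X.sup_K_div_frequently_large[OF assms(5) c(1) unit inf] conv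
    proof eventually_elim
      case (elim \<omega>)
      have "\<forall>\<^sub>F n in sequentially. sup_K_div s (emp_cdf X n \<omega>) < ereal l"
        using elim(2) l by (rule order_tendstoD)
      from frequently_ex[OF frequently_eventually_conj[OF elim(1) this]]
      obtain n where "ereal ((c powr s - 1) / (s * (s - 1))) < ereal l"
        using le_less_trans by blast
      with lc show False by simp
    qed
    then show False by simp
  qed
  moreover have "?J < \<infinity> \<longleftrightarrow> (\<integral>\<^sup>+\<omega>. inverse (ennreal ((Y \<omega> * (1 - Y \<omega>)) powr (1 - 1 / s))) \<partial>M) < \<infinity>"
    if "Y \<in> borel_measurable M" "cdf (distr M borel Y) = F" for Y
  proof -
    have "1 - 1 / s = ?p" using assms(5) by (simp add: diff_divide_distrib)
    with J[OF that] show ?thesis by (simp add: \<phi>_def)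
  qed
  ultimately show ?thesis by blast
qed

end
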